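(* Let $f\in\mathcal{S}_\theta(m,L)$ and consider a $p$-step first-order algorithm ($p\ge1$) with matrices $A(\theta),B(\theta),C(\theta),D(\theta),C_x$ of the lifted form given in the context, run along a parameter sequence $\{\theta_k\}_{k\ge0}\subset\Theta$ that satisfies the rate bound $\underline\nu\le\theta_{k+1}-\theta_k\le\overline\nu$ (componentwise) for all $k$. Assume there is a matrix $U\in\mathbb{R}^{n_\xi\times d}$ such that for all $\theta\in\Theta$ $$(I-A(\theta))U=0,\qquad C(\theta)U=1_p\otimes I_d,\qquad C_xU=I_d,$$ and set $\xi_k^\star=Ux_k^\star$, $\Delta\xi_k^\star=\xi_k^\star-\xi_{k+1}^\star$. For some $\rho\in(0,1)$, let $\hat A,\hat B,\hat B_{\Delta\xi},\hat B_{\Delta g},\hat C,\hat D,\hat D_{\Delta\xi},\hat D_{\Delta g}$ be the ($\theta$-dependent) augmented-plant matrices and $\hat M$ the matrix defined in the context. Suppose there exist a continuous symmetric-matrix-valued function $P:\Theta\to\mathbb{S}^{n_\eta}$, $n_\eta=n_\xi+4dp$, with $P(\theta)\succ0$ for all $\theta\in\Theta$, a vector $\lambda_p=(\lambda_p^1,\dots,\lambda_p^p)\in\mathbb{R}^p_{\ge0}$ and scalars $\gamma_\xi,\gamma_g\ge0$ such that, with $M_\lambda=\mathrm{diag}(\lambda_p)\otimes\hat M$ and $$T(\theta)=\begin{bmatrix} I & 0 & 0 & 0 \\ \hat A & \hat B & \hat B_{\Delta\xi} & \hat B_{\Delta g} \\ \hat C & \hat D & \hat D_{\Delta\xi} &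 \hat D_{\Delta g} \\ 0 & 0 & I & 0 \\ 0 & 0 & 0 & I \end{bmatrix},$$ it holds that $$T(\theta)^\top\,\mathrm{blkdiag}\big(-\rho^2P(\theta),\,P(\theta+\Delta\theta),\,M_\lambda,\,-\gamma_\xi I,\,-\gamma_gI\big)\,T(\theta)\preceq0\qquad\text{for all }(\theta,\Delta\theta)\in\mathcal{V}_{\Theta,\nu}.$$ Then for any $\xi_0$ and all $k\ge0$, with $c_1=\overline\lambda/\underline\lambda$, $c_2=1/\underline\lambda$, $\overline\lambda=\max_{\theta\in\Theta}\lambda_{\max}(P(\theta))$, $\underline\lambda=\min_{\theta\in\Theta}\lambda_{\min}(P(\theta))$, and $m_t=m(\theta_t)$, $L_t=L(\theta_t)$, $$\begin{aligned} \|\xi_k-\xi_k^\star\|^2\le{}&c_1\rho^{2k}\|\xi_0-\xi_0^\star\|^2+c_2\sum_{t=1}^k\rho^{2(k-t)}\Big(\gamma_\xi\|\Delta\xi_{t-1}^\star\|^2+\gamma_g\sum_{i=1}^p\|\Delta g_{t-1}(y_{t-1}^i)\|^2\Big) \\ &+c_2\sum_{i=1}^p\sum_{t=1}^{k-1}\rho^{2(k-t)}\lambda_p^i\Big((L_t-m_t)\hat f_t(y_{t-1}^i)-(L_{t-1}-m_{t-1})\hat f_{t-1}(y_{t-1}^i)\Big). \end{aligned}$$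
   Context: $\Theta\subset\mathbb{R}^{n_\theta}$ is compact. $f\in\mathcal{S}_\theta(m,L)$ means $f:\mathbb{R}^d\times\Theta\to\mathbb{R}$ and: $m,L:\Theta\to\mathbb{R}$ are continuous with $0<\underline m<m(\theta)<L(\theta)<\overline L<\infty$ for all $\theta\in\Theta$ and some scalars $\underline m,\overline L$; $f(\cdot,\theta)$ is $m(\theta)$-strongly convex and $L(\theta)$-smooth (Lipschitz gradient) in $x$; $\nabla_xf(x,\theta)$ is continuous in $\theta$ for every $x$. Notation: $\nabla f_k(\cdot)=\nabla_xf(\cdot,\theta_k)$, $x_k^\star=\arg\min_{x\in\mathbb{R}^d}f(x,\theta_k)$, $\hat f_k(x)=f(x,\theta_k)-f(x_k^\star,\theta_k)$, $\Delta g_k(\cdot)=\nabla f_k(\cdot)-\nabla f_{k+1}(\cdot)$. $\|\cdot\|$ is the Euclidean norm, $\mathbb{S}^n$ the real symmetric $n\times n$ matrices, $1_p$ the all-ones column vector of length $p$, $\otimes$ the Kronecker product. $\mathcal{V}_{\Theta,\nu}=\{(\theta,\Delta\theta):\theta\in\Theta,\ \theta+\Delta\theta\in\Theta,\ \underline\nu\le\Delta\theta\le\overline\nu\}$, with $\underline\nu,\overline\nu\in\mathbb{R}^{n_\theta}$ given and inequalities componentwise. Algorithm: let $\bar A(\theta)\in\mathbb{R}^{n_\xi\times n_\xi}$, $\bar B(\theta)\in\mathbb{R}^{n_\xi\times d}$, $\bar C(\theta)\in\mathbb{R}^{d\times n_\xi}$ be continuous in $\theta\in\Theta$ (the one-step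 algorithm $\hat\xi^+=\bar A\hat\xi+\bar B\nabla f_k(\hat y)$, $\hat y=\bar C\hat\xi$). The corresponding $p$-step algorithm is $$\xi_{k+1}=A(\theta_k)\xi_k+B(\theta_k)u_k,\qquad y_k=C(\theta_k)\xi_k+D(\theta_k)u_k,\qquad u_k=(\nabla f_k(y_k^1),\dots,\nabla f_k(y_k^p)),$$ with $y_k=(y_k^1,\dots,y_k^p)\in(\mathbb{R}^d)^p$, $A=\bar A^p$, $B=[\bar A^{p-1}\bar B\ \cdots\ \bar A\bar B\ \bar B]$, $C$ having block rows $\bar C\bar A^{i-1}$, $i=1,\dots,p$, and $D$ having $d\times d$ blocks $D_{ij}=\bar C\bar A^{i-1-j}\bar B$ for $j<i$ and $D_{ij}=0$ for $j\ge i$. The decision is $x_k=C_x\xi_k$ with constant $C_x\in\mathbb{R}^{d\times n_\xi}$. Filter matrices (depending on $\theta$ and $\rho$): with $m=m(\theta)$, $L=L(\theta)$, $a=\sqrt{m(L-m)/2}$, define $$A_0=0_{4d\times4d},\quad B_0^y=\begin{bmatrix} I_d \\ 0 \\ a I_d \\ -m I_d \end{bmatrix},\quad B_0^u=\begin{bmatrix} 0 \\ I_d \\ 0 \\ I_d \end{bmatrix},\quad B_0^{\Delta x}=\begin{bmatrix} I_d \\ 0 \\ 0 \\ 0 \end{bmatrix},\quad B_0^{\Delta g}=\begin{bmatrix} 0 \\ -I_d \\ 0 \\ 0 \end{bmatrix},$$ $$C_0=\begin{bmatrix} -\rho^2LI_d & \rho^2I_d & 0 & 0 \\ 0 & 0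 & 0 & 0 \\ 0 & 0 & \rho I_d & 0 \\ a\rho I_d & 0 & 0 & 0 \\ 0 & 0 & 0 & \rho I_d \\ -m\rho I_d & \rho I_d & 0 & 0 \end{bmatrix},\quad D_0^y=\begin{bmatrix} LI_d \\ -mI_d \\ 0 \\ 0 \\ 0 \\ 0 \end{bmatrix},\quad D_0^u=\begin{bmatrix} -I_d \\ I_d \\ 0 \\ 0 \\ 0 \\ 0 \end{bmatrix},\quad D_0^{\Delta x}=0,\quad D_0^{\Delta g}=0,$$ and $\hat M=\mathrm{blkdiag}\left(\tfrac12\begin{bmatrix} 0 & I_d \\ I_d & 0 \end{bmatrix},\begin{bmatrix} I_d & 0 \\ 0 & -I_d \end{bmatrix},\tfrac12\begin{bmatrix} I_d & 0 \\ 0 & -I_d \end{bmatrix}\right)$. Stack $p$ copies: $A_\Psi=I_p\otimes A_0$, $C_\Psi=I_p\otimes C_0$, $B_\Psi^\bullet=I_p\otimes B_0^\bullet$ and $D_\Psi^\bullet=I_p\otimes D_0^\bullet$ for $\bullet\in\{y,u,\Delta g\}$, and $B_\Psi^{\Delta x^\star}=1_p\otimes B_0^{\Delta x}$, $D_\Psi^{\Delta x^\star}=1_p\otimes D_0^{\Delta x}$. Augmented-plant matrices: $$\hat A=\begin{bmatrix} A & 0 \\ B_\Psi^yC & A_\Psi \end{bmatrix},\ \hat B=\begin{bmatrix} B \\ B_\Psi^yD+B_\Psi^u \end{bmatrix},\ \hat B_{\Delta\xi}=\begin{bmatrix} I \\ B_\Psi^{\Delta x^\star}C_x \end{bmatrix},\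 \hat B_{\Delta g}=\begin{bmatrix} 0 \\ B_\Psi^{\Delta g} \end{bmatrix},$$ $$\hat C=[D_\Psi^yC\ \ C_\Psi],\quad\hat D=D_\Psi^yD+D_\Psi^u,\quad\hat D_{\Delta\xi}=D_\Psi^{\Delta x^\star}C_x,\quad\hat D_{\Delta g}=D_\Psi^{\Delta g}.$$ *)

theory Defs
  imports "HOL-Analysis.Analysis"
begin

definition grad :: "('a::real_inner \<Rightarrow> real) \<Rightarrow> 'a \<Rightarrow> 'a" where
  "grad h x = (THE D. GDERIV h x :> D)"

definition strongly_convex :: "real \<Rightarrow> ('a::real_inner \<Rightarrow> real) \<Rightarrow> bool" where
  "strongly_convex \<mu> h \<longleftrightarrow>
     (\<forall>x y. \<forall>t\<in>{0..1}.
        h ((1 - t) *\<^sub>R x + t *\<^sub>R y)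
          \<le> (1 - t) * h x + t * h y - \<mu> / 2 * t * (1 - t) * (norm (x - y))\<^sup>2)"

definition smooth_fun :: "real \<Rightarrow> ('a::real_inner \<Rightarrow> real) \<Rightarrow> bool" where
  "smooth_fun K h \<longleftrightarrow> (\<forall>x. \<exists>D. GDERIV h x :> D) \<and> K-lipschitz_on UNIV (grad h)"

definition S_class ::
  "(real^'t) set \<Rightarrow> (real^'t \<Rightarrow> real) \<Rightarrow> (real^'t \<Rightarrow> real) \<Rightarrow> (real^'d \<Rightarrow> real^'t \<Rightarrow> real) \<Rightarrow> bool"
where
  "S_class \<Theta> m L f \<longleftrightarrow>
     continuous_on \<Theta> m \<and> continuous_on \<Theta> L \<and>
     (\<exists>m_lo L_up. 0 < m_lo \<and> (\<forall>\<theta>\<in>\<Theta>. m_lo < m \<theta> \<and> m \<theta> < L \<theta> \<and> L \<theta> < L_up)) \<and>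
     (\<forall>\<theta>\<in>\<Theta>. strongly_convex (m \<theta>) (\<lambda>x. f x \<theta>) \<and> smooth_fun (L \<theta>) (\<lambda>x. f x \<theta>)) \<and>
     (\<forall>x. continuous_on \<Theta> (\<lambda>\<theta>. grad (\<lambda>z. f z \<theta>) x))"

definition grad_at :: "(real^'d \<Rightarrow> real^'t \<Rightarrow> real) \<Rightarrow> real^'t \<Rightarrow> real^'d \<Rightarrow> real^'d" where
  "grad_at f \<theta> = grad (\<lambda>x. f x \<theta>)"

definition minimizer :: "(real^'d \<Rightarrow> real^'t \<Rightarrow> real) \<Rightarrow> real^'t \<Rightarrow> real^'d" where
  "minimizer f \<theta> = arg_min (\<lambda>x. f x \<theta>) (\<lambda>_. True)"

definition f_hat :: "(real^'d \<Rightarrow> real^'t \<Rightarrow> real) \<Rightarrow> real^'t \<Rightarrow> real^'d \<Rightarrow> real" where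
  "f_hat f \<theta> x = f x \<theta> - f (minimizer f \<theta>) \<theta>"

definition V_set :: "(real^'t) set \<Rightarrow> real^'t \<Rightarrow> real^'t \<Rightarrow> ((real^'t) \<times> (real^'t)) set" where
  "V_set \<Theta> \<nu>_lo \<nu>_up =
     {(\<theta>, \<Delta>). \<theta> \<in> \<Theta> \<and> \<theta> + \<Delta> \<in> \<Theta> \<and> \<nu>_lo \<le> \<Delta> \<and> \<Delta> \<le> \<nu>_up}"

text \<open>The product \<open>*\<close> and the powers \<open>^\<close> on \<open>real^'n^'n\<close> are not matrix
  operations, so matrix powers are defined from \<open>**\<close>.\<close>

primrec matpow :: "real^'n^'n \<Rightarrow> nat \<Rightarrow> real^'n^'n" where
  "matpow M 0 = mat 1"
| "matpow M (Suc k) = M ** matpow M k"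

text \<open>Block matrices are indexed by sum types: \<open>M ||| N\<close> is the block row
  \<open>[M N]\<close>, and \<open>M /// N\<close> puts \<open>M\<close> on top of \<open>N\<close>.\<close>

definition hcat :: "real^'b^'a \<Rightarrow> real^'c^'a \<Rightarrow> real^('b + 'c)^'a" (infixr "|||" 64) where
  "M ||| N = (\<chi> i j. case j of Inl b \<Rightarrow> M $ i $ b | Inr c \<Rightarrow> N $ i $ c)"

definition vcat :: "real^'c^'a \<Rightarrow> real^'c^'b \<Rightarrow> real^'c^('a + 'b)" (infixr "'/'/'/" 63) where
  "M /// N = (\<chi> i. case i of Inl a \<Rightarrow> M $ a | Inr b \<Rightarrow> N $ b)"

definition blkdiag :: "real^'b^'a \<Rightarrow> real^'d^'c \<Rightarrow> real^('b + 'd)^('a + 'c)" where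
  "blkdiag M N = (M ||| 0) /// (0 ||| N)"

definition kron :: "real^'b^'a \<Rightarrow> real^'d^'c \<Rightarrow> real^('b \<times> 'd)^('a \<times> 'c)" where
  "kron M N = (\<chi> i j. M $ fst i $ fst j * N $ snd i $ snd j)"

text \<open>Kronecker product \<open>v \<otimes> N\<close> of a column vector \<open>v\<close> with a matrix;
  the column index of \<open>v\<close>, which has one value only, is dropped.\<close>

definition vkron :: "real^'a \<Rightarrow> real^'d^'c \<Rightarrow> real^'d^('a \<times> 'c)" where
  "vkron v N = (\<chi> i j. v $ fst i * N $ snd i $ j)"

definition diag_mat :: "real^'a \<Rightarrow> real^'a^'a" where
  "diag_mat v = (\<chi> i j. if i = j then v $ i else 0)"

definition pos_definite :: "real^'n^'n \<Rightarrow> bool" where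
  "pos_definite M \<longleftrightarrow> transpose M = M \<and> (\<forall>v. v \<noteq> 0 \<longrightarrow> 0 < v \<bullet> (M *v v))"

definition neg_semidefinite :: "real^'n^'n \<Rightarrow> bool" where
  "neg_semidefinite M \<longleftrightarrow> transpose M = M \<and> (\<forall>v. v \<bullet> (M *v v) \<le> 0)"

definition is_eigenvalue :: "real^'n^'n \<Rightarrow> real \<Rightarrow> bool" where
  "is_eigenvalue M \<mu> \<longleftrightarrow> (\<exists>v. v \<noteq> 0 \<and> M *v v = \<mu> *\<^sub>R v)"

definition lambda_max :: "real^'n^'n \<Rightarrow> real" where
  "lambda_max M = (GREATEST \<mu>. is_eigenvalue M \<mu>)"

definition lambda_min :: "real^'n^'n \<Rightarrow> real" where
  "lambda_min M = (LEAST \<mu>. is_eigenvalue M \<mu>)"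

text \<open>The \<open>p\<close> steps are indexed by a finite linearly ordered type \<open>'p\<close>
  with \<open>p = CARD('p)\<close>; \<open>idx i\<close> is the position of \<open>i\<close> in \<open>1, \<dots>, p\<close>.
  Vectors \<open>y = (y\<^sup>1, \<dots>, y\<^sup>p)\<close> of \<open>p\<close> blocks in \<open>real^'d\<close> are indexed by
  \<open>'p \<times> 'd\<close>.\<close>

definition idx :: "'p::{finite,linorder} \<Rightarrow> nat" where
  "idx i = card {j. j \<le> i}"

definition blk :: "real^(('p::finite) \<times> 'd) \<Rightarrow> 'p \<Rightarrow> real^'d" where
  "blk y i = (\<chi> a. y $ (i, a))"

definition stack :: "(('p::finite) \<Rightarrow> real^'d) \<Rightarrow> real^('p \<times> 'd)" where
  "stack w = (\<chi> r. w (fst r) $ snd r)"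

definition lift_B ::
  "real^'n^'n \<Rightarrow> real^'d^'n \<Rightarrow> real^(('p::{finite,linorder}) \<times> 'd)^'n"
where
  "lift_B Ab Bb = (\<chi> r c. (matpow Ab (CARD('p) - idx (fst c)) ** Bb) $ r $ snd c)"

definition lift_C ::
  "real^'n^'n \<Rightarrow> real^'n^'d \<Rightarrow> real^'n^(('p::{finite,linorder}) \<times> 'd)"
where
  "lift_C Ab Cb = (\<chi> r c. (Cb ** matpow Ab (idx (fst r) - 1)) $ snd r $ c)"

definition lift_D ::
  "real^'n^'n \<Rightarrow> real^'d^'n \<Rightarrow> real^'n^'d
     \<Rightarrow> real^(('p::{finite,linorder}) \<times> 'd)^('p \<times> 'd)"
where
  "lift_D Ab Bb Cb =
     (\<chi> r c. if fst c < fst r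
            then (Cb ** matpow Ab (idx (fst r) - 1 - idx (fst c)) ** Bb) $ snd r $ snd c
            else 0)"

text \<open>All blocks of the filter matrices are multiples of \<open>I\<^sub>d\<close>, so each matrix is the
  Kronecker product of its matrix of coefficients with \<open>I\<^sub>d\<close>. The filter state is
  indexed by \<open>4 \<times> 'd\<close> and the filter output by \<open>6 \<times> 'd\<close>.\<close>

definition A0 :: "real^(4 \<times> ('d::finite))^(4 \<times> 'd)" where
  "A0 = 0"

definition B0_y :: "real \<Rightarrow> real \<Rightarrow> real^'d^(4 \<times> 'd)" where
  "B0_y m L = vkron (vector [1, 0, sqrt (m * (L - m) / 2), - m]) (mat 1)"

definition B0_u :: "real^'d^(4 \<times> 'd)" where
  "B0_u = vkron (vector [0, 1, 0, 1]) (mat 1)"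

definition B0_dx :: "real^'d^(4 \<times> 'd)" where
  "B0_dx = vkron (vector [1, 0, 0, 0]) (mat 1)"

definition B0_dg :: "real^'d^(4 \<times> 'd)" where
  "B0_dg = vkron (vector [0, - 1, 0, 0]) (mat 1)"

definition C0 :: "real \<Rightarrow> real \<Rightarrow> real \<Rightarrow> real^(4 \<times> ('d::finite))^(6 \<times> 'd)" where
  "C0 m L \<rho> =
     (let a = sqrt (m * (L - m) / 2) in
      kron (vector [vector [- (\<rho>\<^sup>2 * L), \<rho>\<^sup>2, 0, 0],
                    vector [0, 0, 0, 0],
                    vector [0, 0, \<rho>, 0],
                    vector [a * \<rho>, 0, 0, 0],
                    vector [0, 0, 0, \<rho>],
                    vector [- (m * \<rho>), \<rho>, 0, 0]])
           (mat 1))"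

definition D0_y :: "real \<Rightarrow> real \<Rightarrow> real^'d^(6 \<times> 'd)" where
  "D0_y m L = vkron (vector [L, - m, 0, 0, 0, 0]) (mat 1)"

definition D0_u :: "real^'d^(6 \<times> 'd)" where
  "D0_u = vkron (vector [- 1, 1, 0, 0, 0, 0]) (mat 1)"

definition D0_dx :: "real^'d^(6 \<times> 'd)" where
  "D0_dx = 0"

definition D0_dg :: "real^'d^(6 \<times> 'd)" where
  "D0_dg = 0"

definition M_hat :: "real^(6 \<times> ('d::finite))^(6 \<times> 'd)" where
  "M_hat =
     kron (vector [vector [0, 1/2, 0, 0, 0, 0],
                   vector [1/2, 0, 0, 0, 0, 0],
                   vector [0, 0, 1, 0, 0, 0],
                   vector [0, 0, 0, - 1, 0, 0],
                   vector [0, 0, 0, 0, 1/2, 0],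
                   vector [0, 0, 0, 0, 0, - 1/2]])
          (mat 1)"

definition A_Psi :: "real^(('p::finite) \<times> (4 \<times> ('d::finite)))^('p \<times> (4 \<times> 'd))" where
  "A_Psi = kron (mat 1) A0"

definition B_Psi_y :: "real \<Rightarrow> real \<Rightarrow> real^(('p::finite) \<times> ('d::finite))^('p \<times> (4 \<times> 'd))" where
  "B_Psi_y m L = kron (mat 1) (B0_y m L)"

definition B_Psi_u :: "real^(('p::finite) \<times> ('d::finite))^('p \<times> (4 \<times> 'd))" where
  "B_Psi_u = kron (mat 1) B0_u"

definition B_Psi_dx :: "real^'d^(('p::finite) \<times> (4 \<times> 'd))" where
  "B_Psi_dx = vkron 1 B0_dx"

definition B_Psi_dg :: "real^(('p::finite) \<times> ('d::finite))^('p \<times> (4 \<times> 'd))" where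
  "B_Psi_dg = kron (mat 1) B0_dg"

definition C_Psi :: "real \<Rightarrow> real \<Rightarrow> real \<Rightarrow> real^(('p::finite) \<times> (4 \<times> ('d::finite)))^('p \<times> (6 \<times> 'd))" where
  "C_Psi m L \<rho> = kron (mat 1) (C0 m L \<rho>)"

definition D_Psi_y :: "real \<Rightarrow> real \<Rightarrow> real^(('p::finite) \<times> ('d::finite))^('p \<times> (6 \<times> 'd))" where
  "D_Psi_y m L = kron (mat 1) (D0_y m L)"

definition D_Psi_u :: "real^(('p::finite) \<times> ('d::finite))^('p \<times> (6 \<times> 'd))" where
  "D_Psi_u = kron (mat 1) D0_u"

definition D_Psi_dx :: "real^'d^(('p::finite) \<times> (6 \<times> 'd))" where
  "D_Psi_dx = vkron 1 D0_dx"

definition D_Psi_dg :: "real^(('p::finite) \<times> ('d::finite))^('p \<times> (6 \<times> 'd))" where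
  "D_Psi_dg = kron (mat 1) D0_dg"

type_synonym ('n, 'p, 'd) eta = "'n + 'p \<times> (4 \<times> 'd)"

definition A_hat ::
  "real \<Rightarrow> real \<Rightarrow> real^'n^'n \<Rightarrow> real^'n^(('p::finite) \<times> ('d::finite))
     \<Rightarrow> real^('n, 'p, 'd) eta^('n, 'p, 'd) eta"
where
  "A_hat m L A C = (A ||| 0) /// (B_Psi_y m L ** C ||| A_Psi)"

definition B_hat ::
  "real \<Rightarrow> real \<Rightarrow> real^(('p::finite) \<times> ('d::finite))^'n \<Rightarrow> real^('p \<times> 'd)^('p \<times> 'd)
     \<Rightarrow> real^('p \<times> 'd)^('n, 'p, 'd) eta"
where
  "B_hat m L B D = B /// (B_Psi_y m L ** D + B_Psi_u)"

definition B_hat_dxi :: "real^'n^'d \<Rightarrow> real^'n^('n, ('p::finite), 'd) eta" where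
  "B_hat_dxi Cx = mat 1 /// B_Psi_dx ** Cx"

definition B_hat_dg :: "real^(('p::finite) \<times> ('d::finite))^(('n::finite), 'p, 'd) eta" where
  "B_hat_dg = 0 /// B_Psi_dg"

definition C_hat ::
  "real \<Rightarrow> real \<Rightarrow> real \<Rightarrow> real^'n^(('p::finite) \<times> ('d::finite)) \<Rightarrow> real^('n, 'p, 'd) eta^('p \<times> (6 \<times> 'd))"
where
  "C_hat m L \<rho> C = D_Psi_y m L ** C ||| C_Psi m L \<rho>"

definition D_hat ::
  "real \<Rightarrow> real \<Rightarrow> real^(('p::finite) \<times> ('d::finite))^('p \<times> 'd) \<Rightarrow> real^('p \<times> 'd)^('p \<times> (6 \<times> 'd))"
where
  "D_hat m L D = D_Psi_y m L ** D + D_Psi_u"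

definition D_hat_dxi :: "real^'n^'d \<Rightarrow> real^'n^(('p::finite) \<times> (6 \<times> 'd))" where
  "D_hat_dxi Cx = D_Psi_dx ** Cx"

definition D_hat_dg :: "real^(('p::finite) \<times> ('d::finite))^('p \<times> (6 \<times> 'd))" where
  "D_hat_dg = D_Psi_dg"

definition T_mat ::
  "real \<Rightarrow> real \<Rightarrow> real
     \<Rightarrow> real^'n^'n \<Rightarrow> real^(('p::finite) \<times> 'd)^'n \<Rightarrow> real^'n^('p \<times> 'd) \<Rightarrow> real^('p \<times> 'd)^('p \<times> 'd)
     \<Rightarrow> real^'n^'d
     \<Rightarrow> real^(('n, 'p, 'd) eta + ('p \<times> 'd) + 'n + ('p \<times> 'd))
            ^(('n, 'p, 'd) eta + ('n, 'p, 'd) eta + ('p \<times> (6 \<times> 'd)) + 'n + ('p \<times> 'd))"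
where
  "T_mat m L \<rho> A B C D Cx =
        (mat 1       ||| 0           ||| 0            ||| 0)
    /// (A_hat m L A C   ||| B_hat m L B D ||| B_hat_dxi Cx ||| B_hat_dg)
    /// (C_hat m L \<rho> C   ||| D_hat m L D   ||| D_hat_dxi Cx ||| D_hat_dg)
    /// (0           ||| 0           ||| mat 1        ||| 0)
    /// (0           ||| 0           ||| 0            ||| mat 1)"

definition M_lambda :: "real^'p \<Rightarrow> real^('p \<times> (6 \<times> ('d::finite)))^('p \<times> (6 \<times> 'd))" where
  "M_lambda lam = kron (diag_mat lam) M_hat"

end

theory Submission
  imports Defs
begin

text \<open>
  The proof is a dissipativity argument with a storage function that has two parts.

  For a function \<open>h\<close> that is \<open>m\<close>-strongly convex and \<open>L\<close>-smooth with minimizer \<open>z\<close>, the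
  interpolation inequality says that the gap
  \<open>q x = (L - m) * (h x - h z) - m * (L - m) / 2 * (norm (x - z))\<^sup>2
    - (norm (grad h x - m *\<^sub>R (x - z)))\<^sup>2 / 2\<close>
  is nonnegative, and that differences \<open>q x - q w\<close> are bounded by an inner product of sector
  residuals of \<open>x\<close> and \<open>w\<close> (\<open>interpolation_gap_multiplier_bound\<close>). The filter computes exactly this inner
  product between the current iterate \<open>y\<close> and the previous iterate \<open>w\<close>, damped by \<open>\<rho>\<^sup>2\<close>, so that
  its first two outputs supply at least \<open>q\<^sub>k y - \<rho>\<^sup>2 * q\<^sub>k w\<close>, where \<open>q\<^sub>k\<close> is the gap of the function
  at time \<open>k\<close> (\<open>multiplier_bound_shifted\<close>). This would telescope if the function stayed the same. It does
  not, and the other four outputs exchange the quadratic parts of \<open>q\<^sub>k w\<close> for those of \<open>q\<^sub>k\<^sub>-\<^sub>1 w\<close>. What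
  cannot be exchanged is the function value: its change is the drift term
  \<open>(L\<^sub>k - m\<^sub>k) * fhat\<^sub>k w - (L\<^sub>k\<^sub>-\<^sub>1 - m\<^sub>k\<^sub>-\<^sub>1) * fhat\<^sub>k\<^sub>-\<^sub>1 w\<close>, with \<open>fhat\<^sub>k\<close> the suboptimality at time \<open>k\<close>,
  which remains in the final bound.

  The matrix inequality, evaluated along a trajectory, bounds the new quadratic form plus the
  weighted supply by \<open>\<rho>\<^sup>2\<close> times the old one plus the disturbance terms (\<open>dissipation_inequality\<close>).
  Hence \<open>W\<close>, the quadratic form plus the weighted previous gaps, contracts by \<open>\<rho>\<^sup>2\<close> up to drift and
  disturbances, and \<open>geometric_recursion_bound\<close> unrolls this. The gaps are nonnegative and absent at
  time \<open>0\<close>, so eigenvalue bounds for \<open>P\<close> translate \<open>W\<close> into the error norm at both ends; compactness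
  and joint continuity of the Rayleigh quotient make these bounds uniform over the parameter set
  (\<open>greatest_lambda_max\<close>, \<open>least_lambda_min\<close>).
\<close>

section \<open>Strongly convex smooth functions and the interpolation gap\<close>

text \<open>The constant \<open>grad\<close> is a definite description, so this needs uniqueness of the derivative.\<close>

lemma GDERIV_grad:
  fixes h :: "'a::real_inner \<Rightarrow> real"
  assumes "smooth_fun K h"
  shows "GDERIV h x :> grad h x"
proof -
  obtain D where D: "GDERIV h x :> D"
    using assms unfolding smooth_fun_def by blast
  have "D' = D" if "GDERIV h x :> D'" for D'
  proof -
    have "(\<lambda>z. z \<bullet> D') = (\<lambda>z. z \<bullet> D)"
      using has_derivative_unique[of h "\<lambda>z. z \<bullet> D'" x "\<lambda>z. z \<bullet> D"] that D
      unfolding gderiv_def by blast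
    then show ?thesis
      by (simp add: fun_eq_iff vector_eq_ldot)
  qed
  then have "grad h x = D"
    unfolding grad_def using D by blast
  with D show ?thesis by simp
qed

lemma DERIV_along_segment:
  fixes h :: "'a::real_inner \<Rightarrow> real"
  assumes "smooth_fun K h"
  shows "((\<lambda>t. h (x + t *\<^sub>R d)) has_real_derivative d \<bullet> grad h (x + t *\<^sub>R d)) (at t)"
proof -
  have "((\<lambda>t. x + t *\<^sub>R d) has_derivative (\<lambda>s. s *\<^sub>R d)) (at t)"
    by (auto intro!: derivative_eq_intros)
  moreover have "(h has_derivative (\<lambda>z. z \<bullet> grad h (x + t *\<^sub>R d))) (at (x + t *\<^sub>R d))"
    using GDERIV_grad[OF assms] unfolding gderiv_def .
  ultimately have "((\<lambda>t. h (x + t *\<^sub>R d)) has_derivative (\<lambda>s. (s *\<^sub>R d) \<bullet> grad h (x + t *\<^sub>R d))) (at t)"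
    by (rule has_derivative_compose)
  then show ?thesis
    by (simp add: has_field_derivative_def mult.commute[of _ "d \<bullet> grad h (x + t *\<^sub>R d)"])
qed

text \<open>Divide the defining inequality by \<open>t\<close> and let \<open>t\<close> tend to \<open>0\<close> from the right.\<close>

lemma strongly_convex_gradient_lower_bound:
  fixes h :: "'a::real_inner \<Rightarrow> real"
  assumes sm: "smooth_fun K h" and sc: "strongly_convex \<mu> h"
  shows "h x + (y - x) \<bullet> grad h x + \<mu> / 2 * (norm (y - x))\<^sup>2 \<le> h y"
proof -
  have 1: "((\<lambda>t. (h (x + t *\<^sub>R (y - x)) - h x) / t) \<longlongrightarrow> (y - x) \<bullet> grad h x) (at_right 0)"
    using DERIV_along_segment[OF sm, of x "y - x" 0]
    by (auto simp: has_field_derivative_iff intro: tendsto_mono[OF at_within_le_at])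
  have 2: "((\<lambda>t. h y - h x - \<mu> / 2 * (1 - t) * (norm (y - x))\<^sup>2)
      \<longlongrightarrow> h y - h x - \<mu> / 2 * (1 - 0) * (norm (y - x))\<^sup>2) (at_right 0)"
    by (intro tendsto_intros)
  have 3: "\<forall>\<^sub>F t in at_right 0. (h (x + t *\<^sub>R (y - x)) - h x) / t
      \<le> h y - h x - \<mu> / 2 * (1 - t) * (norm (y - x))\<^sup>2"
  proof (rule eventually_at_rightI[of 0 1])
    fix t :: real assume t: "t \<in> {0<..<1}"
    have "h ((1 - t) *\<^sub>R x + t *\<^sub>R y)
        \<le> (1 - t) * h x + t * h y - \<mu> / 2 * t * (1 - t) * (norm (x - y))\<^sup>2"
      using sc t unfolding strongly_convex_def by simp
    moreover have "(1 - t) *\<^sub>R x + t *\<^sub>R y = x + t *\<^sub>R (y - x)"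
      by (simp add: algebra_simps)
    ultimately have "h (x + t *\<^sub>R (y - x)) - h x
        \<le> t * (h y - h x - \<mu> / 2 * (1 - t) * (norm (y - x))\<^sup>2)"
      by (simp add: algebra_simps norm_minus_commute)
    with t show "(h (x + t *\<^sub>R (y - x)) - h x) / t
        \<le> h y - h x - \<mu> / 2 * (1 - t) * (norm (y - x))\<^sup>2"
      by (simp add: divide_le_eq mult.commute)
  qed simp
  from tendsto_le[OF _ 2 1 3] show ?thesis by simp
qed

text \<open>Along the segment from \<open>x\<close> to \<open>y\<close>, the difference of the two sides is monotone, because the
  gradient is Lipschitz.\<close>

lemma smooth_upper_bound:
  fixes h :: "'a::real_inner \<Rightarrow> real"
  assumes sm: "smooth_fun K h"
  shows "h y \<le> h x + (y - x) \<bullet> grad h x + K / 2 * (norm (y - x))\<^sup>2"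
proof -
  define d where "d = y - x"
  define \<phi> where "\<phi> t = h (x + t *\<^sub>R d) - t * (d \<bullet> grad h x) - K / 2 * t\<^sup>2 * (norm d)\<^sup>2" for t
  have "\<phi> 1 \<le> \<phi> 0"
  proof (rule DERIV_nonpos_imp_nonincreasing[of 0 1])
    fix t :: real assume t: "0 \<le> t" "t \<le> 1"
    have "(\<phi> has_real_derivative d \<bullet> grad h (x + t *\<^sub>R d) - d \<bullet> grad h x - K * t * (norm d)\<^sup>2) (at t)"
      unfolding \<phi>_def
      by (rule derivative_eq_intros DERIV_along_segment[OF sm] refl | simp)+
    moreover have "d \<bullet> grad h (x + t *\<^sub>R d) - d \<bullet> grad h x - K * t * (norm d)\<^sup>2 \<le> 0"
    proof -
      have "dist (grad h (x + t *\<^sub>R d)) (grad h x) \<le> K * dist (x + t *\<^sub>R d) x"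
        using sm unfolding smooth_fun_def by (blast intro: lipschitz_onD)
      then have g: "norm (grad h (x + t *\<^sub>R d) - grad h x) \<le> K * (t * norm d)"
        using t by (simp add: dist_norm)
      have "d \<bullet> (grad h (x + t *\<^sub>R d) - grad h x) \<le> norm d * norm (grad h (x + t *\<^sub>R d) - grad h x)"
        by (rule norm_cauchy_schwarz)
      also have "\<dots> \<le> norm d * (K * (t * norm d))"
        using g by (simp add: mult_left_mono)
      finally show ?thesis
        by (simp add: inner_diff_right power2_eq_square mult_ac)
    qed
    ultimately show "\<exists>D. (\<phi> has_real_derivative D) (at t) \<and> D \<le> 0"
      by blast
  qed simp
  then show ?thesis
    by (simp add: \<phi>_def d_def)
qed

text \<open>The constant \<open>minimizer\<close> is a choice operator, so its value is meaningful only once a minimizer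
  is known to exist. Strong convexity makes \<open>h\<close> exceed \<open>h 0\<close> outside a large ball, and on the ball
  compactness applies.\<close>

lemma minimizer_stationary:
  fixes h :: "'a::euclidean_space \<Rightarrow> real"
  assumes sm: "smooth_fun K h" and sc: "strongly_convex \<mu> h" and "0 < \<mu>"
  shows "grad h (arg_min h (\<lambda>_. True)) = 0"
proof -
  \<comment> \<open>outside radius \<open>R\<close> the quadratic term of the lower bound at \<open>0\<close> dominates the linear one\<close>
  define R where "R = 2 * norm (grad h 0) / \<mu>"
  have R0: "0 \<le> R" using \<open>0 < \<mu>\<close> by (simp add: R_def)
  have "continuous_on UNIV h"
    using GDERIV_grad[OF sm] unfolding gderiv_def
    by (meson has_derivative_continuous continuous_at_imp_continuous_on)
  then obtain z where z: "z \<in> cball 0 R" "\<And>x. x \<in> cball 0 R \<Longrightarrow> h z \<le> h x"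
    using continuous_attains_inf[of "cball (0::'a) R" h] R0
    by (meson compact_cball continuous_on_subset subset_UNIV cball_eq_empty not_le)
  have far: "h 0 \<le> h x" if "x \<notin> cball 0 R" for x
  proof -
    have nx: "R < norm x" using that by simp
    have "- (norm x * norm (grad h 0)) \<le> x \<bullet> grad h 0"
      using Cauchy_Schwarz_ineq2[of x "grad h 0"] by linarith
    moreover have "norm x * norm (grad h 0) \<le> \<mu> / 2 * (norm x)\<^sup>2"
    proof -
      have "2 * norm (grad h 0) \<le> \<mu> * norm x"
        using nx \<open>0 < \<mu>\<close> by (simp add: R_def divide_less_eq mult.commute)
      then have "norm x * (2 * norm (grad h 0)) \<le> norm x * (\<mu> * norm x)"
        by (rule mult_left_mono) simp
      then show ?thesis by (simp add: power2_eq_square algebra_simps)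
    qed
    ultimately show ?thesis
      using strongly_convex_gradient_lower_bound[OF sm sc, of 0 x] by simp
  qed
  have "h z \<le> h x" for x
    using z(2)[of x] z(2)[of 0] far[of x] R0 by fastforce
  then have "is_arg_min h (\<lambda>_. True) z"
    by (simp add: is_arg_min_linorder)
  then have min: "is_arg_min h (\<lambda>_. True) (arg_min h (\<lambda>_. True))"
    unfolding arg_min_def by (rule someI)
  define w where "w = arg_min h (\<lambda>_. True)"
  have "(h has_derivative (\<lambda>v. v \<bullet> grad h w)) (at w)"
    using GDERIV_grad[OF sm] unfolding gderiv_def .
  then have "(\<lambda>v. v \<bullet> grad h w) = (\<lambda>v. 0)"
    using min by (intro differential_zero_maxmin[of w UNIV h]) (auto simp: is_arg_min_linorder w_def)
  then have "grad h w \<bullet> grad h w = 0"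
    by meson
  then show ?thesis by (simp add: w_def)
qed

text \<open>Subtracting \<open>\<mu> / 2 * (norm x)\<^sup>2\<close> turns the sector \<open>[\<mu>, K]\<close> into \<open>[0, K - \<mu>]\<close>: the
  function \<open>H\<close> is convex and has the quadratic upper bound with constant \<open>K - \<mu>\<close>. A gradient step from
  \<open>x\<close> of length \<open>1 / (K - \<mu>)\<close> for \<open>H\<close> minus its linearization at \<open>y\<close> cannot get below the minimum \<open>0\<close> of
  that difference, which is the claim.\<close>

lemma sector_interpolation:
  fixes h :: "'a::real_inner \<Rightarrow> real" and \<mu> K :: real
  assumes sm: "smooth_fun K h" and sc: "strongly_convex \<mu> h" and "\<mu> < K"
  defines "H \<equiv> \<lambda>x. h x - \<mu> / 2 * (norm x)\<^sup>2"
    and "G \<equiv> \<lambda>x. grad h x - \<mu> *\<^sub>R x"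
  shows "(norm (G x - G y))\<^sup>2 / 2 \<le> (K - \<mu>) * (H x - H y - (x - y) \<bullet> G y)"
proof -
  have low: "H a + (b - a) \<bullet> G a \<le> H b" for a b
    using strongly_convex_gradient_lower_bound[OF sm sc, of a b]
    by (simp add: H_def G_def power2_norm_eq_inner inner_commute
        algebra_simps add_divide_distrib diff_divide_distrib)
  have up: "H b \<le> H a + (b - a) \<bullet> G a + (K - \<mu>) / 2 * (norm (b - a))\<^sup>2" for a b
    using smooth_upper_bound[OF sm, of b a]
    by (simp add: H_def G_def power2_norm_eq_inner inner_commute
        algebra_simps add_divide_distrib diff_divide_distrib)
  define w where "w = G x - G y"
  define z where "z = x - (1 / (K - \<mu>)) *\<^sub>R w"
  have "H y + (z - y) \<bullet> G y \<le> H z" by (rule low)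
  also have "\<dots> \<le> H x + (z - x) \<bullet> G x + (K - \<mu>) / 2 * (norm (z - x))\<^sup>2" by (rule up)
  finally have "0 \<le> H x - H y - (x - y) \<bullet> G y + (z - x) \<bullet> w + (K - \<mu>) / 2 * (norm (z - x))\<^sup>2"
    by (simp add: w_def inner_diff_right inner_diff_left)
  moreover have "(z - x) \<bullet> w + (K - \<mu>) / 2 * (norm (z - x))\<^sup>2 = - ((norm w)\<^sup>2 / 2 / (K - \<mu>))"
    using \<open>\<mu> < K\<close>
    by (simp add: z_def power_mult_distrib power2_norm_eq_inner[symmetric] power_divide
      divide_simps power2_eq_square)
  ultimately have "(norm w)\<^sup>2 / 2 / (K - \<mu>) \<le> H x - H y - (x - y) \<bullet> G y"
    by linarith
  moreover have "0 < K - \<mu>" using \<open>\<mu> < K\<close> by simp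
  ultimately have "(norm w)\<^sup>2 / 2 \<le> (H x - H y - (x - y) \<bullet> G y) * (K - \<mu>)"
    by (simp only: pos_divide_le_eq)
  then show ?thesis
    by (simp only: w_def mult.commute)
qed

text \<open>This is \<open>(K - \<mu>) * H x - (norm (grad H x))\<^sup>2 / 2\<close> for the shifted function
  \<open>H x = h x - h z - \<mu> / 2 * (norm (x - z))\<^sup>2\<close>; with \<open>z\<close> the minimizer of \<open>h\<close>, it is the slack in
  the inequality between \<open>x\<close> and \<open>z\<close> of \<open>sector_interpolation\<close>.\<close>

definition interpolation_gap :: "real \<Rightarrow> real \<Rightarrow> ('a::real_inner \<Rightarrow> real) \<Rightarrow> 'a \<Rightarrow> 'a \<Rightarrow> real" where
  "interpolation_gap \<mu> K h z x =
     (K - \<mu>) * (h x - h z) - \<mu> * (K - \<mu>) / 2 * (norm (x - z))\<^sup>2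
       - (norm (grad h x - \<mu> *\<^sub>R (x - z)))\<^sup>2 / 2"

text \<open>The inner product of the two sector residuals bounds a difference of gaps. In this form the
  interpolation inequality telescopes along the iterates, so the gap can serve as a storage function.\<close>

lemma interpolation_gap_multiplier_bound:
  fixes h :: "'a::real_inner \<Rightarrow> real" and \<mu> K :: real
  assumes sm: "smooth_fun K h" and sc: "strongly_convex \<mu> h" and "\<mu> < K" and "grad h z = 0"
  shows "interpolation_gap \<mu> K h z x - interpolation_gap \<mu> K h z w
    \<le> (K *\<^sub>R (x - z) - grad h x - (K *\<^sub>R (w - z) - grad h w)) \<bullet> (grad h x - \<mu> *\<^sub>R (x - z))"
  using sector_interpolation[OF sm sc \<open>\<mu> < K\<close>, of w x]
  unfolding interpolation_gap_def power2_norm_eq_inner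
  by (simp add: inner_commute algebra_simps add_divide_distrib diff_divide_distrib)

lemma interpolation_gap_self [simp]:
  "grad h z = 0 \<Longrightarrow> interpolation_gap \<mu> K h z z = 0"
  by (simp add: interpolation_gap_def)

lemma interpolation_gap_nonneg:
  fixes h :: "'a::real_inner \<Rightarrow> real"
  assumes sm: "smooth_fun K h" and sc: "strongly_convex \<mu> h" and "\<mu> < K" and "grad h z = 0"
  shows "0 \<le> interpolation_gap \<mu> K h z x"
  using sector_interpolation[OF sm sc \<open>\<mu> < K\<close>, of x z] assms(4)
  unfolding interpolation_gap_def power2_norm_eq_inner
  by (simp add: inner_commute algebra_simps add_divide_distrib diff_divide_distrib)

text \<open>The factor \<open>\<rho>\<^sup>2\<close> is introduced by a convex combination: weight \<open>\<rho>\<^sup>2\<close> on the multiplier bound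
  between \<open>x\<close> and \<open>w\<close>, weight \<open>1 - \<rho>\<^sup>2\<close> on the one between \<open>x\<close> and the minimizer \<open>z\<close>.\<close>

lemma multiplier_bound_shifted:
  fixes h :: "'a::real_inner \<Rightarrow> real"
  assumes "smooth_fun K h" "strongly_convex \<mu> h" "\<mu> < K" "grad h z = 0" and "\<rho>\<^sup>2 \<le> 1"
  shows "interpolation_gap \<mu> K h z x - \<rho>\<^sup>2 * interpolation_gap \<mu> K h z w
    \<le> (K *\<^sub>R (x - z) - grad h x - \<rho>\<^sup>2 *\<^sub>R (K *\<^sub>R (w - z) - grad h w))
        \<bullet> (grad h x - \<mu> *\<^sub>R (x - z))"
proof -
  define v where "v = grad h x - \<mu> *\<^sub>R (x - z)"
  define r where "r y = K *\<^sub>R (y - z) - grad h y" for y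
  define q where "q = interpolation_gap \<mu> K h z"
  have "q x - q w \<le> (r x - r w) \<bullet> v" "q x \<le> r x \<bullet> v"
    using interpolation_gap_multiplier_bound[OF assms(1-4), of x w]
      interpolation_gap_multiplier_bound[OF assms(1-4), of x z] \<open>grad h z = 0\<close>
    by (simp_all add: q_def r_def v_def)
  then have "\<rho>\<^sup>2 * (q x - q w) + (1 - \<rho>\<^sup>2) * q x \<le> \<rho>\<^sup>2 * ((r x - r w) \<bullet> v) + (1 - \<rho>\<^sup>2) * (r x \<bullet> v)"
    using \<open>\<rho>\<^sup>2 \<le> 1\<close> by (intro add_mono mult_left_mono) auto
  then have "q x - \<rho>\<^sup>2 * q w \<le> (r x - \<rho>\<^sup>2 *\<^sub>R r w) \<bullet> v"
    by (simp add: inner_diff_left algebra_simps)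
  then show ?thesis
    by (simp only: q_def r_def v_def)
qed

section \<open>Extreme eigenvalues of a continuous family of symmetric matrices\<close>

lemma inner_symmetric_matrix:
  fixes M :: "real^'n^'n"
  assumes "transpose M = M"
  shows "x \<bullet> (M *v y) = (M *v x) \<bullet> y"
  by (metis assms dot_lmul_matrix transpose_matrix_vector)

text \<open>The form \<open>\<mu> * (norm v)\<^sup>2 - v \<bullet> (M *v v)\<close> is nonnegative and vanishes at \<open>w\<close>, so its
  first-order variation at \<open>w\<close> in the direction of the residual vanishes too; that variation is a
  multiple of the squared norm of the residual.\<close>

lemma Rayleigh_bound_attained_imp_eigenvector:
  fixes M :: "real^'n^'n"
  assumes sym: "transpose M = M"
    and bound: "\<And>v. v \<bullet> (M *v v) \<le> \<mu> * (norm v)\<^sup>2"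
    and att: "w \<bullet> (M *v w) = \<mu> * (norm w)\<^sup>2"
  shows "M *v w = \<mu> *\<^sub>R w"
proof -
  define r where "r = M *v w - \<mu> *\<^sub>R w"
  define b where "b = \<mu> * (norm r)\<^sup>2 - r \<bullet> (M *v r)"
  have b0: "0 \<le> b" using bound[of r] by (simp add: b_def)
  have key: "2 * t * (norm r)\<^sup>2 \<le> t\<^sup>2 * b" for t
  proof -
    have "(w + t *\<^sub>R r) \<bullet> (M *v (w + t *\<^sub>R r)) =
        w \<bullet> (M *v w) + 2 * t * (r \<bullet> (M *v w)) + t\<^sup>2 * (r \<bullet> (M *v r))"
      using inner_symmetric_matrix[OF sym, of w r]
      by (simp add: matrix_vector_right_distrib matrix_vector_mult_scaleR inner_add_left
          inner_add_right power2_eq_square algebra_simps inner_commute)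
    moreover have "(norm (w + t *\<^sub>R r))\<^sup>2 = (norm w)\<^sup>2 + 2 * t * (r \<bullet> w) + t\<^sup>2 * (norm r)\<^sup>2"
      unfolding power2_norm_eq_inner
      by (simp add: inner_add_left inner_add_right power2_eq_square algebra_simps inner_commute)
    moreover have "r \<bullet> (M *v w) = (norm r)\<^sup>2 + \<mu> * (r \<bullet> w)"
      by (simp add: r_def power2_norm_eq_inner inner_diff_left inner_diff_right algebra_simps
          inner_commute)
    ultimately show ?thesis
      using bound[of "w + t *\<^sub>R r"] att by (simp add: b_def algebra_simps)
  qed
  have "(norm r)\<^sup>2 \<le> 0"
  proof (rule ccontr)
    assume "\<not> (norm r)\<^sup>2 \<le> 0"
    then have pos: "0 < (norm r)\<^sup>2" by simp
    \<comment> \<open>any small enough step contradicts \<open>key\<close>; \<open>b + 1\<close> avoids a division by zero\<close>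
    define t where "t = (norm r)\<^sup>2 / (b + 1)"
    have t: "0 < t" using pos b0 by (simp add: t_def)
    have "2 * (norm r)\<^sup>2 \<le> t * b"
      using key[of t] t by (simp add: power2_eq_square)
    also have "t * b \<le> (norm r)\<^sup>2"
      using b0 pos by (simp add: t_def divide_le_eq algebra_simps)
    finally show False using pos by simp
  qed
  then have "r = 0" by simp
  then show ?thesis by (simp add: r_def)
qed

lemma Rayleigh_le_from_unit_sphere:
  fixes M :: "real^'n^'n"
  assumes "\<And>v. norm v = 1 \<Longrightarrow> v \<bullet> (M *v v) \<le> \<mu>"
  shows "v \<bullet> (M *v v) \<le> \<mu> * (norm v)\<^sup>2"
proof (cases "v = 0")
  case False
  define r where "r = norm v"
  define e where "e = (1 / r) *\<^sub>R v"
  have "norm e = 1" and v: "v = r *\<^sub>R e" using False by (simp_all add: e_def r_def)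
  have "v \<bullet> (M *v v) = r\<^sup>2 * (e \<bullet> (M *v e))"
    unfolding v by (simp add: matrix_vector_mult_scaleR power2_eq_square)
  also have "\<dots> \<le> r\<^sup>2 * \<mu>"
    using assms[OF \<open>norm e = 1\<close>] by (simp add: mult_left_mono)
  finally show ?thesis
    by (simp add: r_def mult.commute)
qed simp

lemma eigenvalue_Rayleigh:
  fixes M :: "real^'n^'n"
  assumes "is_eigenvalue M \<mu>"
  obtains v where "norm v = 1" "v \<bullet> (M *v v) = \<mu>"
proof -
  from assms obtain v where v: "v \<noteq> 0" "M *v v = \<mu> *\<^sub>R v"
    unfolding is_eigenvalue_def by blast
  show thesis
  proof (rule that[of "(1 / norm v) *\<^sub>R v"])
    show "(1 / norm v) *\<^sub>R v \<bullet> (M *v ((1 / norm v) *\<^sub>R v)) = \<mu>"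
      using v by (simp add: matrix_vector_mult_scaleR dot_square_norm power2_eq_square)
  qed (use v in simp)
qed

text \<open>The maximum of the quadratic form on the unit sphere exists by compactness, is an eigenvalue,
  and bounds every other eigenvalue.
  Hence the operator \<open>GREATEST\<close> in the definition of \<open>lambda_max\<close> has a witness and the constant has
  its intended meaning.\<close>

lemma lambda_max_Rayleigh:
  fixes M :: "real^'n^'n"
  assumes sym: "transpose M = M"
  shows "is_eigenvalue M (lambda_max M)"
    and "\<And>\<mu>. is_eigenvalue M \<mu> \<Longrightarrow> \<mu> \<le> lambda_max M"
    and "\<And>v. v \<bullet> (M *v v) \<le> lambda_max M * (norm v)\<^sup>2"
proof -
  have "\<exists>w\<in>sphere 0 1. \<forall>v\<in>sphere 0 1. v \<bullet> (M *v v) \<le> w \<bullet> (M *v w)"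
    by (rule continuous_attains_sup) (auto intro!: continuous_intros matrix_vector_mult_linear_continuous_on)
  then obtain w where w: "norm w = 1" "\<And>v. norm v = 1 \<Longrightarrow> v \<bullet> (M *v v) \<le> w \<bullet> (M *v w)"
    by auto
  define \<mu> where "\<mu> = w \<bullet> (M *v w)"
  have bound: "v \<bullet> (M *v v) \<le> \<mu> * (norm v)\<^sup>2" for v
    using w(2) unfolding \<mu>_def by (rule Rayleigh_le_from_unit_sphere)
  have ev: "is_eigenvalue M \<mu>"
    unfolding is_eigenvalue_def
    using Rayleigh_bound_attained_imp_eigenvector[OF sym bound, of w] w(1)
    by (intro exI[of _ w]) (auto simp: \<mu>_def)
  have max: "\<mu>' \<le> \<mu>" if "is_eigenvalue M \<mu>'" for \<mu>'
    using that by (metis eigenvalue_Rayleigh w(2) \<mu>_def)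
  have "lambda_max M = \<mu>"
    unfolding lambda_max_def by (rule Greatest_equality) (use ev max in auto)
  with ev max bound show "is_eigenvalue M (lambda_max M)"
    "\<And>\<mu>. is_eigenvalue M \<mu> \<Longrightarrow> \<mu> \<le> lambda_max M"
    "\<And>v. v \<bullet> (M *v v) \<le> lambda_max M * (norm v)\<^sup>2"
    by auto
qed

lemma transpose_uminus: "transpose (- M) = - transpose (M::real^'n^'m)"
  by (simp add: transpose_def vec_eq_iff)

lemma uminus_matrix_vector_mult: "(- M) *v v = - ((M::real^'n^'m) *v v)"
  by (simp add: matrix_vector_mult_def vec_eq_iff sum_negf)

lemma lambda_min_eq_lambda_max_uminus:
  fixes M :: "real^'n^'n"
  assumes sym: "transpose M = M"
  shows "lambda_min M = - lambda_max (- M)"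
proof -
  have sym': "transpose (- M) = - M" using sym by (simp add: transpose_uminus)
  have ev: "is_eigenvalue (- M) \<mu> \<longleftrightarrow> is_eigenvalue M (- \<mu>)" for \<mu>
    unfolding is_eigenvalue_def uminus_matrix_vector_mult by (metis minus_equation_iff scaleR_minus_left)
  show ?thesis
    unfolding lambda_min_def
  proof (rule Least_equality)
    show "is_eigenvalue M (- lambda_max (- M))"
      using lambda_max_Rayleigh(1)[OF sym'] ev by simp
    show "- lambda_max (- M) \<le> \<mu>" if "is_eigenvalue M \<mu>" for \<mu>
      using lambda_max_Rayleigh(2)[OF sym', of "- \<mu>"] ev[of "- \<mu>"] that by simp
  qed
qed

text \<open>The quadratic form is jointly continuous in parameter and vector, so it has a maximum on the
  product of \<open>S\<close> and the unit sphere. At a maximizer, the parameter is the one with the greatest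
  largest eigenvalue.\<close>

lemma greatest_lambda_max:
  fixes P :: "'a::topological_space \<Rightarrow> real^'n^'n"
  assumes "compact S" "S \<noteq> {}" and cont: "continuous_on S P"
    and sym: "\<And>s. s \<in> S \<Longrightarrow> transpose (P s) = P s"
  obtains s where "s \<in> S"
    "(GREATEST l. l \<in> (\<lambda>s. lambda_max (P s)) ` S) = lambda_max (P s)"
    "\<And>r v. r \<in> S \<Longrightarrow> v \<bullet> (P r *v v) \<le> lambda_max (P s) * (norm v)\<^sup>2"
proof -
  have "continuous_on (S \<times> sphere 0 1) (\<lambda>(s, v). v \<bullet> (P s *v v))"
    unfolding case_prod_beta matrix_vector_mult_def inner_vec_def
    by (intro continuous_intros continuous_on_compose2[OF cont]) auto
  moreover have "S \<times> sphere (0::real^'n) 1 \<noteq> {}" using assms(2) by simp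
  ultimately obtain q where q: "q \<in> S \<times> sphere 0 1"
    "\<forall>r\<in>S \<times> sphere 0 1. (case r of (s, v) \<Rightarrow> v \<bullet> (P s *v v)) \<le> (case q of (s, v) \<Rightarrow> v \<bullet> (P s *v v))"
    using continuous_attains_sup[OF compact_Times[OF \<open>compact S\<close> compact_sphere]] by blast
  obtain s w where sw: "q = (s, w)" by fastforce
  have s: "s \<in> S" and w: "norm w = 1"
    and max: "\<And>r v. r \<in> S \<Longrightarrow> norm v = 1 \<Longrightarrow> v \<bullet> (P r *v v) \<le> w \<bullet> (P s *v w)"
    using q unfolding sw by auto
  have le: "w \<bullet> (P s *v w) \<le> lambda_max (P s)"
    using lambda_max_Rayleigh(3)[OF sym[OF s], of w] w by simp
  have bound: "v \<bullet> (P r *v v) \<le> lambda_max (P s) * (norm v)\<^sup>2" if "r \<in> S" for r v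
    using max[OF that] le by (intro Rayleigh_le_from_unit_sphere) (meson order_trans)
  have "lambda_max (P r) \<le> lambda_max (P s)" if r: "r \<in> S" for r
    using eigenvalue_Rayleigh[OF lambda_max_Rayleigh(1)[OF sym[OF r]]] max[OF r] le
    by (metis order_trans)
  then have "(GREATEST l. l \<in> (\<lambda>s. lambda_max (P s)) ` S) = lambda_max (P s)"
    using s by (intro Greatest_equality) auto
  with s bound that show thesis by blast
qed

lemma least_lambda_min:
  fixes P :: "'a::topological_space \<Rightarrow> real^'n^'n"
  assumes "compact S" "S \<noteq> {}" and cont: "continuous_on S P"
    and sym: "\<And>s. s \<in> S \<Longrightarrow> transpose (P s) = P s"
  obtains s where "s \<in> S"
    "(LEAST l. l \<in> (\<lambda>s. lambda_min (P s)) ` S) = lambda_min (P s)"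
    "\<And>r v. r \<in> S \<Longrightarrow> lambda_min (P s) * (norm v)\<^sup>2 \<le> v \<bullet> (P r *v v)"
proof -
  have "continuous_on S (\<lambda>s. - P s)" by (intro continuous_intros cont)
  moreover have sym': "\<And>s. s \<in> S \<Longrightarrow> transpose (- P s) = - P s"
    by (simp add: transpose_uminus sym)
  ultimately obtain s where s: "s \<in> S"
    "\<And>r v. r \<in> S \<Longrightarrow> v \<bullet> (- P r *v v) \<le> lambda_max (- P s) * (norm v)\<^sup>2"
    using greatest_lambda_max[OF assms(1,2)] by metis
  have bound: "lambda_min (P s) * (norm v)\<^sup>2 \<le> v \<bullet> (P r *v v)" if "r \<in> S" for r v
    using s(2)[OF that, of v]
    by (simp add: lambda_min_eq_lambda_max_uminus[OF sym[OF s(1)]] uminus_matrix_vector_mult)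
  have "lambda_min (P s) \<le> lambda_min (P r)" if r: "r \<in> S" for r
  proof -
    obtain v where v: "norm v = 1" "v \<bullet> (- P r *v v) = lambda_max (- P r)"
      using eigenvalue_Rayleigh[OF lambda_max_Rayleigh(1)[OF sym'[OF r]]] by blast
    then show ?thesis
      using s(2)[OF r, of v]
      by (simp add: lambda_min_eq_lambda_max_uminus[OF sym] s(1) r)
  qed
  then have "(LEAST l. l \<in> (\<lambda>s. lambda_min (P s)) ` S) = lambda_min (P s)"
    using s(1) by (intro Least_equality) auto
  with s(1) bound that show thesis by blast
qed

lemma lambda_min_pos:
  fixes M :: "real^'n^'n"
  assumes "pos_definite M"
  shows "0 < lambda_min M"
proof -
  have sym: "transpose M = M" using assms by (simp add: pos_definite_def)
  then have "transpose (- M) = - M" by (simp add: transpose_uminus)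
  then obtain v where v: "norm v = 1" "v \<bullet> (- M *v v) = lambda_max (- M)"
    using eigenvalue_Rayleigh[OF lambda_max_Rayleigh(1)] by blast
  have "v \<noteq> 0" using v(1) by auto
  then have "0 < v \<bullet> (M *v v)" using assms by (simp add: pos_definite_def)
  with v(2) show ?thesis
    by (simp add: lambda_min_eq_lambda_max_uminus[OF sym] uminus_matrix_vector_mult)
qed

section \<open>Block vectors and block matrices\<close>

text \<open>Block vectors that match the sum-type indices of \<open>|||\<close>, \<open>///\<close> and \<open>blkdiag\<close>.\<close>

definition vjoin :: "real^'a \<Rightarrow> real^'b \<Rightarrow> real^('a + 'b)" where
  "vjoin x y = (\<chi> i. case i of Inl a \<Rightarrow> x $ a | Inr b \<Rightarrow> y $ b)"

lemma sum_UNIV_Plus: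
  "(\<Sum>i\<in>(UNIV :: ('a::finite + 'b::finite) set). F i) = (\<Sum>a\<in>UNIV. F (Inl a)) + (\<Sum>b\<in>UNIV. F (Inr b))"
  by (simp add: UNIV_Plus_UNIV[symmetric] sum.Plus del: UNIV_Plus_UNIV)

lemma inner_vjoin: "vjoin x y \<bullet> vjoin x' y' = x \<bullet> x' + y \<bullet> y'"
  by (simp add: inner_vec_def sum_UNIV_Plus vjoin_def)

lemma vjoin_add: "vjoin x y + vjoin x' y' = vjoin (x + x') (y + y')"
  by (auto simp: vjoin_def vec_eq_iff split: sum.split)

lemma norm_vjoin: "(norm (vjoin x y))\<^sup>2 = (norm x)\<^sup>2 + (norm y)\<^sup>2"
  by (simp add: power2_norm_eq_inner inner_vjoin)

lemma vcat_mult: "(M /// N) *v x = vjoin (M *v x) (N *v x)"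
  by (auto simp: vcat_def vjoin_def vec_eq_iff matrix_vector_mult_def split: sum.split)

lemma hcat_mult: "(M ||| N) *v vjoin x y = M *v x + N *v y"
  by (simp add: hcat_def vjoin_def vec_eq_iff matrix_vector_mult_def sum_UNIV_Plus)

lemma blkdiag_mult: "blkdiag M N *v vjoin x y = vjoin (M *v x) (N *v y)"
  by (simp add: blkdiag_def vcat_mult hcat_mult)

lemma sum_UNIV_prod:
  "(\<Sum>i\<in>(UNIV :: ('a::finite \<times> 'b::finite) set). F i) = (\<Sum>a\<in>UNIV. \<Sum>b\<in>UNIV. F (a, b))"
  by (simp add: sum.cartesian_product flip: UNIV_Times_UNIV)

lemma blk_eqI: "(\<And>i. blk x i = blk y i) \<Longrightarrow> x = y"
  by (simp add: blk_def vec_eq_iff)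

lemma blk_add [simp]: "blk (x + y) i = blk x i + blk y i"
  and blk_diff [simp]: "blk (x - y) i = blk x i - blk y i"
  and blk_0 [simp]: "blk 0 i = 0"
  and blk_stack [simp]: "blk (stack w) i = w i"
  by (simp_all add: blk_def stack_def vec_eq_iff)

lemma inner_blk: "x \<bullet> y = (\<Sum>i\<in>UNIV. blk x i \<bullet> blk y i)"
  by (simp add: inner_vec_def blk_def sum_UNIV_prod)

lemma norm_blk: "(norm x)\<^sup>2 = (\<Sum>i\<in>UNIV. (norm (blk x i))\<^sup>2)"
  by (simp add: power2_norm_eq_inner inner_blk)

lemma blk_kron: "blk (kron M N *v x) i = (\<Sum>j\<in>UNIV. M $ i $ j *\<^sub>R (N *v blk x j))"
  by (simp add: kron_def blk_def matrix_vector_mult_def vec_eq_iff sum_UNIV_prod sum_distrib_left mult.assoc)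

lemma blk_vkron: "blk (vkron v N *v x) i = v $ i *\<^sub>R (N *v x)"
  by (simp add: vkron_def blk_def matrix_vector_mult_def vec_eq_iff sum_distrib_left mult.assoc)

lemma blk_kron_mat_1: "blk (kron (mat 1) N *v x) i = N *v blk x i"
  by (simp add: blk_kron mat_def if_distrib[of "\<lambda>c. c *\<^sub>R _"] cong: if_cong)

lemma blk_kron_diag_mat: "blk (kron (diag_mat v) N *v x) i = v $ i *\<^sub>R (N *v blk x i)"
  by (simp add: blk_kron diag_mat_def if_distrib[of "\<lambda>c. c *\<^sub>R _"] cong: if_cong)

lemma exhaust_6:
  fixes x :: 6
  shows "x = 1 \<or> x = 2 \<or> x = 3 \<or> x = 4 \<or> x = 5 \<or> x = 6"
proof (induct x)
  case (of_int z)
  then have "0 \<le> z" and "z < 6" by simp_all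
  then have "z = 0 \<or> z = 1 \<or> z = 2 \<or> z = 3 \<or> z = 4 \<or> z = 5" by arith
  then show ?case by auto
qed

lemma UNIV_6: "UNIV = {1, 2, 3, 4, 5, 6::6}"
  using exhaust_6 by auto

lemma sum_6: "sum F (UNIV :: 6 set) = F 1 + F 2 + F 3 + F 4 + F 5 + F 6"
  unfolding UNIV_6 by (simp add: ac_simps)

lemma vector_4 [simp]:
  "(vector [a, b, c, d] :: 'a::zero^4) $ 1 = a"
  "(vector [a, b, c, d] :: 'a::zero^4) $ 2 = b"
  "(vector [a, b, c, d] :: 'a::zero^4) $ 3 = c"
  "(vector [a, b, c, d] :: 'a::zero^4) $ 4 = d"
  unfolding vector_def by simp_all

lemma vector_6 [simp]:
  "(vector [a, b, c, d, e, g] :: 'a::zero^6) $ 1 = a"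
  "(vector [a, b, c, d, e, g] :: 'a::zero^6) $ 2 = b"
  "(vector [a, b, c, d, e, g] :: 'a::zero^6) $ 3 = c"
  "(vector [a, b, c, d, e, g] :: 'a::zero^6) $ 4 = d"
  "(vector [a, b, c, d, e, g] :: 'a::zero^6) $ 5 = e"
  "(vector [a, b, c, d, e, g] :: 'a::zero^6) $ 6 = g"
  unfolding vector_def by simp_all

text \<open>Blocks 1 and 2 carry the interpolation multiplier; the four remaining blocks, in difference form,
  correct it for the change of the function between two steps.\<close>

lemma M_hat_quadratic_form:
  fixes z :: "real^(6 \<times> ('d::finite))"
  shows "z \<bullet> (M_hat *v z) = blk z 1 \<bullet> blk z 2 + (norm (blk z 3))\<^sup>2 - (norm (blk z 4))\<^sup>2
     + (norm (blk z 5))\<^sup>2 / 2 - (norm (blk z 6))\<^sup>2 / 2"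
  unfolding inner_blk[of z] M_hat_def
  by (simp add: blk_kron sum_6 power2_norm_eq_inner inner_commute)

lemma M_lambda_quadratic_form:
  fixes z :: "real^(('p::finite) \<times> (6 \<times> ('d::finite)))"
  shows "z \<bullet> (M_lambda lam *v z) = (\<Sum>i\<in>UNIV. lam $ i * (blk z i \<bullet> (M_hat *v blk z i)))"
  unfolding M_lambda_def inner_blk[of z] by (simp add: blk_kron_diag_mat)

lemma neg_semidefinite_congruence:
  fixes S :: "real^'m^'m" and T :: "real^'n^'m"
  assumes "neg_semidefinite (transpose T ** S ** T)"
  shows "(T *v v) \<bullet> (S *v (T *v v)) \<le> 0"
proof -
  have "v \<bullet> ((transpose T ** S ** T) *v v) \<le> 0"
    using assms by (simp add: neg_semidefinite_def)
  moreover have "v \<bullet> ((transpose T ** S ** T) *v v) = (T *v v) \<bullet> (S *v (T *v v))"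
    by (metis dot_lmul_matrix inner_commute matrix_vector_mul_assoc transpose_matrix_vector)
  ultimately show ?thesis by simp
qed

section \<open>The filter and the augmented plant\<close>

text \<open>Since \<open>A0 = 0\<close>, the filter has memory one and its next state is a function of the inputs
  alone. When \<open>y\<close>, \<open>u\<close>, \<open>dx\<close>, \<open>dg\<close> are the error of the iterates, their gradients, and the changes of
  minimizer and gradient, its four blocks are the error relative to the next minimizer, the gradient of the
  next function at the old iterate, and two blocks that remember what the old gap was made of.\<close>

definition filter_step ::
  "real \<Rightarrow> real \<Rightarrow> real^('p \<times> 'd) \<Rightarrow> real^('p \<times> 'd) \<Rightarrow> real^'d \<Rightarrow> real^('p \<times> 'd)
     \<Rightarrow> real^(('p::finite) \<times> (4 \<times> ('d::finite)))"
where
  "filter_step \<mu> K y u dx dg = stack (\<lambda>i. stack (\<lambda>j. vector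
     [blk y i + dx, blk u i - blk dg i, sqrt (\<mu> * (K - \<mu>) / 2) *\<^sub>R blk y i,
      blk u i - \<mu> *\<^sub>R blk y i] $ j))"

definition filter_output ::
  "real \<Rightarrow> real \<Rightarrow> real \<Rightarrow> real^('p \<times> (4 \<times> 'd)) \<Rightarrow> real^('p \<times> 'd) \<Rightarrow> real^('p \<times> 'd)
     \<Rightarrow> real^(('p::finite) \<times> (6 \<times> ('d::finite)))"
where
  "filter_output \<mu> K \<rho> \<psi> y u = stack (\<lambda>i. stack (\<lambda>j. vector
     [K *\<^sub>R blk y i - blk u i - \<rho>\<^sup>2 *\<^sub>R (K *\<^sub>R blk (blk \<psi> i) 1 - blk (blk \<psi> i) 2),
      blk u i - \<mu> *\<^sub>R blk y i,
      \<rho> *\<^sub>R blk (blk \<psi> i) 3,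
      (sqrt (\<mu> * (K - \<mu>) / 2) * \<rho>) *\<^sub>R blk (blk \<psi> i) 1,
      \<rho> *\<^sub>R blk (blk \<psi> i) 4,
      \<rho> *\<^sub>R (blk (blk \<psi> i) 2 - \<mu> *\<^sub>R blk (blk \<psi> i) 1)] $ j))"

lemma filter_step_eq:
  "filter_step \<mu> K y u dx dg =
     B_Psi_y \<mu> K *v y + A_Psi *v \<psi> + B_Psi_u *v u + B_Psi_dx *v dx + B_Psi_dg *v dg"
proof (intro blk_eqI)
  fix i j
  show "blk (blk (filter_step \<mu> K y u dx dg) i) j = blk (blk (B_Psi_y \<mu> K *v y + A_Psi *v \<psi>
      + B_Psi_u *v u + B_Psi_dx *v dx + B_Psi_dg *v dg) i) j"
    using exhaust_4[of j]
    by (auto simp: filter_step_def B_Psi_y_def A_Psi_def B_Psi_u_def B_Psi_dx_def B_Psi_dg_def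
        B0_y_def A0_def B0_u_def B0_dx_def B0_dg_def blk_kron_mat_1 blk_vkron)
qed

lemma filter_output_eq:
  "filter_output \<mu> K \<rho> \<psi> y u = D_Psi_y \<mu> K *v y + C_Psi \<mu> K \<rho> *v \<psi> + D_Psi_u *v u"
proof (intro blk_eqI)
  fix i j
  have "blk (D_Psi_y \<mu> K *v y + C_Psi \<mu> K \<rho> *v \<psi> + D_Psi_u *v u) i =
      D0_y \<mu> K *v blk y i + C0 \<mu> K \<rho> *v blk \<psi> i + D0_u *v blk u i"
    by (simp add: D_Psi_y_def C_Psi_def D_Psi_u_def blk_kron_mat_1)
  then show "blk (blk (filter_output \<mu> K \<rho> \<psi> y u) i) j =
      blk (blk (D_Psi_y \<mu> K *v y + C_Psi \<mu> K \<rho> *v \<psi> + D_Psi_u *v u) i) j"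
    using exhaust_6[of j]
    by (auto simp: filter_output_def D0_y_def C0_def D0_u_def blk_vkron blk_kron sum_4 Let_def
        scaleR_diff_right mult.commute)
qed

lemma D_Psi_dx_eq_0: "D_Psi_dx = 0" and D_Psi_dg_eq_0: "D_Psi_dg = 0"
  by (simp_all add: D_Psi_dx_def D_Psi_dg_def D0_dx_def D0_dg_def vkron_def kron_def vec_eq_iff)

lemma T_mat_mult:
  fixes x dx :: "real^'n" and u dg :: "real^(('p::finite) \<times> ('d::finite))"
  assumes "y = C *v x + D *v u"
  shows "T_mat \<mu> K \<rho> A B C D Cx *v vjoin (vjoin x \<psi>) (vjoin u (vjoin dx dg)) =
    vjoin (vjoin x \<psi>)
      (vjoin (vjoin (A *v x + B *v u + dx) (filter_step \<mu> K y u (Cx *v dx) dg))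
        (vjoin (filter_output \<mu> K \<rho> \<psi> y u) (vjoin dx dg)))"
  unfolding T_mat_def assms
  by (simp add: vcat_mult hcat_mult A_hat_def B_hat_def B_hat_dxi_def B_hat_dg_def C_hat_def
      D_hat_def D_hat_dxi_def D_hat_dg_def D_Psi_dx_eq_0 D_Psi_dg_eq_0 vjoin_add
      filter_step_eq[where \<psi> = \<psi>] filter_output_eq matrix_vector_mult_add_rdistrib
      matrix_vector_right_distrib matrix_vector_mul_assoc add_ac)

text \<open>Evaluating the matrix inequality at the stacked vector of state, input and disturbances: the five
  diagonal blocks become the old and new storage, the multiplier supply and the two disturbance terms.\<close>

lemma dissipation_inequality:
  fixes x dx :: "real^'n" and u dg :: "real^(('p::finite) \<times> ('d::finite))"
    and P P' :: "real^('n, 'p, 'd) eta^('n, 'p, 'd) eta"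
  assumes y: "y = C *v x + D *v u"
    and \<eta>: "\<eta> = vjoin x \<psi>"
    and \<eta>': "\<eta>' = vjoin (A *v x + B *v u + dx) (filter_step \<mu> K y u (Cx *v dx) dg)"
    and z: "z = filter_output \<mu> K \<rho> \<psi> y u"
    and lmi: "let T = T_mat \<mu> K \<rho> A B C D Cx in neg_semidefinite (transpose T
      ** blkdiag (- (\<rho>\<^sup>2) *\<^sub>R P)
           (blkdiag P' (blkdiag (M_lambda lam) (blkdiag (- \<gamma>\<^sub>1 *\<^sub>R mat 1) (- \<gamma>\<^sub>2 *\<^sub>R mat 1))))
      ** T)"
  shows "\<eta>' \<bullet> (P' *v \<eta>') + (\<Sum>i\<in>UNIV. lam $ i * (blk z i \<bullet> (M_hat *v blk z i)))
    \<le> \<rho>\<^sup>2 * (\<eta> \<bullet> (P *v \<eta>)) + (\<gamma>\<^sub>1 * (norm dx)\<^sup>2 + \<gamma>\<^sub>2 * (\<Sum>i\<in>UNIV. (norm (blk dg i))\<^sup>2))"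
  using neg_semidefinite_congruence[OF lmi[unfolded Let_def],
      of "vjoin (vjoin x \<psi>) (vjoin u (vjoin dx dg))"]
  unfolding T_mat_mult[OF y] M_lambda_quadratic_form[symmetric] norm_blk[symmetric] \<eta> \<eta>' z
  by (simp add: blkdiag_mult inner_vjoin uminus_matrix_vector_mult
      scaleR_matrix_vector_assoc[symmetric] power2_norm_eq_inner)

text \<open>Along a trajectory, the terms in \<open>s 3\<close> and \<open>s 4\<close> are the squared norms in the
  \<open>interpolation_gap\<close> of the previous function at the previous iterate, and the two negative terms are
  those of the current function at the same point.\<close>

lemma blk_filter_output_quadratic_form:
  fixes y :: "real^(('p::finite) \<times> ('d::finite))"
  assumes "0 \<le> \<mu>" "\<mu> \<le> K" and s: "s = blk (blk \<psi> i)"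
  shows "blk (filter_output \<mu> K \<rho> \<psi> y u) i \<bullet> (M_hat *v blk (filter_output \<mu> K \<rho> \<psi> y u) i) =
     (K *\<^sub>R blk y i - blk u i - \<rho>\<^sup>2 *\<^sub>R (K *\<^sub>R s 1 - s 2)) \<bullet> (blk u i - \<mu> *\<^sub>R blk y i)
     + \<rho>\<^sup>2 * ((norm (s 3))\<^sup>2 + (norm (s 4))\<^sup>2 / 2
         - \<mu> * (K - \<mu>) / 2 * (norm (s 1))\<^sup>2 - (norm (s 2 - \<mu> *\<^sub>R s 1))\<^sup>2 / 2)"
proof -
  define a where "a = sqrt (\<mu> * (K - \<mu>) / 2)"
  have a: "a\<^sup>2 = \<mu> * (K - \<mu>) / 2"
    using assms(1,2) by (simp add: a_def)
  show ?thesis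
    unfolding M_hat_quadratic_form s filter_output_def a_def[symmetric]
    by (simp add: power_mult_distrib a) (simp add: ring_distribs mult_ac)
qed

section \<open>Convergence of the tracking error\<close>

text \<open>Both \<open>d t\<close> and \<open>e t\<close> enter at step \<open>t + 1\<close>, but \<open>d t\<close> carries a factor \<open>r\<close>. With weight
  \<open>r ^ (k - t)\<close> in both sums, the sum of \<open>e\<close> is therefore shifted by one index, and the sum of \<open>d\<close> ends at
  \<open>k - 1\<close>; it starts at \<open>1\<close> because \<open>d 0 = 0\<close>.\<close>

lemma geometric_recursion_bound:
  fixes W d e :: "nat \<Rightarrow> real"
  assumes step: "\<And>k. W (Suc k) \<le> r * W k + r * d k + e k" and "0 \<le> r" and "d 0 = 0"
  shows "W k \<le> r ^ k * W 0 + (\<Sum>t = 1..k. r ^ (k - t) * e (t - 1)) + (\<Sum>t = 1..k - 1. r ^ (k - t) * d t)"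
proof (induction k)
  case (Suc k)
  have pow: "r * (\<Sum>t = 1..l. r ^ (k - t) * b t) = (\<Sum>t = 1..l. r ^ (Suc k - t) * b t)"
    if "l \<le> k" for l b
    unfolding sum_distrib_left using that by (intro sum.cong) (auto simp: Suc_diff_le)
  have d: "r * (\<Sum>t = 1..k - 1. r ^ (k - t) * d t) + r * d k = (\<Sum>t = 1..k. r ^ (Suc k - t) * d t)"
    using \<open>d 0 = 0\<close> unfolding pow[OF diff_le_self] by (cases k) simp_all
  have "W (Suc k) \<le> r * (r ^ k * W 0 + (\<Sum>t = 1..k. r ^ (k - t) * e (t - 1))
      + (\<Sum>t = 1..k - 1. r ^ (k - t) * d t)) + r * d k + e k"
    using step[of k] mult_left_mono[OF Suc.IH \<open>0 \<le> r\<close>] by linarith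
  then show ?case
    using d pow[OF order_refl, of "\<lambda>t. e (t - 1)"] by (simp add: distrib_left)
qed simp

theorem theorem5p4:
  fixes \<Theta> :: "(real^'t) set"
    and m L :: "real^'t \<Rightarrow> real"
    and f :: "real^'d \<Rightarrow> real^'t \<Rightarrow> real"
    and \<nu>_lo \<nu>_up :: "real^'t"
    and Abar :: "real^'t \<Rightarrow> real^'n^'n"
    and Bbar :: "real^'t \<Rightarrow> real^'d^'n"
    and Cbar :: "real^'t \<Rightarrow> real^'n^'d"
    and A :: "real^'t \<Rightarrow> real^'n^'n"
    and B :: "real^'t \<Rightarrow> real^(('p::{finite,linorder}) \<times> 'd)^'n"
    and C :: "real^'t \<Rightarrow> real^'n^('p \<times> 'd)"
    and D :: "real^'t \<Rightarrow> real^('p \<times> 'd)^('p \<times> 'd)"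
    and Cx :: "real^'n^'d"
    and U :: "real^'d^'n"
    and \<theta> :: "nat \<Rightarrow> real^'t"
    and \<xi> \<xi>_star \<Delta>\<xi>_star :: "nat \<Rightarrow> real^'n"
    and y u :: "nat \<Rightarrow> real^('p \<times> 'd)"
    and \<Delta>g :: "nat \<Rightarrow> real^'d \<Rightarrow> real^'d"
    and \<rho> \<gamma>_\<xi> \<gamma>_g lam_up lam_lo c1 c2 :: real
    and lam :: "(real, 'p) vec"
    and P :: "real^'t \<Rightarrow> real^('n, 'p, 'd) eta^('n, 'p, 'd) eta"
  defines "A \<equiv> \<lambda>\<theta>. matpow (Abar \<theta>) CARD('p)"
    and "B \<equiv> \<lambda>\<theta>. lift_B (Abar \<theta>) (Bbar \<theta>)"
    and "C \<equiv> \<lambda>\<theta>. lift_C (Abar \<theta>) (Cbar \<theta>)"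
    and "D \<equiv> \<lambda>\<theta>. lift_D (Abar \<theta>) (Bbar \<theta>) (Cbar \<theta>)"
    and "\<xi>_star \<equiv> \<lambda>k. U *v minimizer f (\<theta> k)"
    and "\<Delta>\<xi>_star \<equiv> \<lambda>k. \<xi>_star k - \<xi>_star (k + 1)"
    and "\<Delta>g \<equiv> \<lambda>k x. grad_at f (\<theta> k) x - grad_at f (\<theta> (k + 1)) x"
    and "lam_up \<equiv> (GREATEST l. l \<in> (\<lambda>\<theta>. lambda_max (P \<theta>)) ` \<Theta>)"
    and "lam_lo \<equiv> (LEAST l. l \<in> (\<lambda>\<theta>. lambda_min (P \<theta>)) ` \<Theta>)"
    and "c1 \<equiv> lam_up / lam_lo"
    and "c2 \<equiv> 1 / lam_lo"
  assumes "compact \<Theta>"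
    and "S_class \<Theta> m L f"
    and "continuous_on \<Theta> Abar" "continuous_on \<Theta> Bbar" "continuous_on \<Theta> Cbar"
    and "\<And>k. \<theta> k \<in> \<Theta>"
    and "\<And>k. \<nu>_lo \<le> \<theta> (k + 1) - \<theta> k \<and> \<theta> (k + 1) - \<theta> k \<le> \<nu>_up"
    and "\<And>k. \<xi> (k + 1) = A (\<theta> k) *v \<xi> k + B (\<theta> k) *v u k"
    and "\<And>k. y k = C (\<theta> k) *v \<xi> k + D (\<theta> k) *v u k"
    and "\<And>k. u k = stack (\<lambda>i. grad_at f (\<theta> k) (blk (y k) i))"
    and "\<And>\<theta>. \<theta> \<in> \<Theta> \<Longrightarrow> (mat 1 - A \<theta>) ** U = 0"
    and "\<And>\<theta>. \<theta> \<in> \<Theta> \<Longrightarrow> C \<theta> ** U = vkron 1 (mat 1)"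
    and "Cx ** U = mat 1"
    and "0 < \<rho>" "\<rho> < 1"
    and "continuous_on \<Theta> P"
    and "\<And>\<theta>. \<theta> \<in> \<Theta> \<Longrightarrow> pos_definite (P \<theta>)"
    and "\<And>i. 0 \<le> lam $ i"
    and "0 \<le> \<gamma>_\<xi>" "0 \<le> \<gamma>_g"
    and "\<And>\<theta> \<Delta>\<theta>. (\<theta>, \<Delta>\<theta>) \<in> V_set \<Theta> \<nu>_lo \<nu>_up \<Longrightarrow>
           (let T = T_mat (m \<theta>) (L \<theta>) \<rho> (A \<theta>) (B \<theta>) (C \<theta>) (D \<theta>) Cx
            in neg_semidefinite
                 (transpose T
                  ** blkdiag (- (\<rho>\<^sup>2) *\<^sub>R P \<theta>)
                       (blkdiag (P (\<theta> + \<Delta>\<theta>))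
                         (blkdiag (M_lambda lam)
                           (blkdiag (- \<gamma>_\<xi> *\<^sub>R mat 1) (- \<gamma>_g *\<^sub>R mat 1))))
                  ** T))"
  shows "(norm (\<xi> k - \<xi>_star k))\<^sup>2
    \<le> c1 * \<rho> ^ (2 * k) * (norm (\<xi> 0 - \<xi>_star 0))\<^sup>2
      + c2 * (\<Sum>t = 1..k. \<rho> ^ (2 * (k - t)) *
                (\<gamma>_\<xi> * (norm (\<Delta>\<xi>_star (t - 1)))\<^sup>2
                 + \<gamma>_g * (\<Sum>i\<in>UNIV. (norm (\<Delta>g (t - 1) (blk (y (t - 1)) i)))\<^sup>2)))
      + c2 * (\<Sum>i\<in>UNIV. \<Sum>t = 1..k - 1. \<rho> ^ (2 * (k - t)) * lam $ i *
                ((L (\<theta> t) - m (\<theta> t)) * f_hat f (\<theta> t) (blk (y (t - 1)) i)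
                 - (L (\<theta> (t - 1)) - m (\<theta> (t - 1))) * f_hat f (\<theta> (t - 1)) (blk (y (t - 1)) i)))"
proof -
  note S = \<open>S_class \<Theta> m L f\<close> and \<theta> = \<open>\<And>k. \<theta> k \<in> \<Theta>\<close> and \<Theta> = \<open>compact \<Theta>\<close>
    and P_cont = \<open>continuous_on \<Theta> P\<close> and P_pos = \<open>\<And>\<theta>. \<theta> \<in> \<Theta> \<Longrightarrow> pos_definite (P \<theta>)\<close>
  define r where "r = \<rho>\<^sup>2"
  have r: "0 \<le> r" "r \<le> 1"
    using \<open>0 < \<rho>\<close> \<open>\<rho> < 1\<close> by (simp_all add: r_def power_le_one)
  define mk Lk where "mk k = m (\<theta> k)" and "Lk k = L (\<theta> k)" for k
  define h where "h k = (\<lambda>x. f x (\<theta> k))" for k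
  define z where "z k = minimizer f (\<theta> k)" for k
  have sc: "strongly_convex (mk k) (h k)" and sm: "smooth_fun (Lk k) (h k)"
    and m0: "0 < mk k" and mL: "mk k < Lk k" for k
    using S \<theta>[of k] unfolding S_class_def mk_def Lk_def h_def by force+
  have gz: "grad (h k) (z k) = 0" for k
    using minimizer_stationary[OF sm sc m0] by (simp add: z_def minimizer_def h_def)
  define yb where "yb k i = blk (y k) i" for k i
  define q where "q k = interpolation_gap (mk k) (Lk k) (h k) (z k)" for k
  have q0: "0 \<le> q k x" for k x
    unfolding q_def by (rule interpolation_gap_nonneg[OF sm sc mL gz])

  \<comment> \<open>error coordinates: the relations for \<open>U\<close> make \<open>\<xi>_star\<close> an equilibrium, so the dynamics keep their
    form and the motion of the minimizer enters as the input \<open>\<Delta>\<xi>_star\<close>\<close>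
  define xe where "xe k = \<xi> k - \<xi>_star k" for k
  define ye where "ye k = y k - vkron 1 (mat 1) *v z k" for k
  define dg where "dg k = stack (\<lambda>i. \<Delta>g k (yb k i))" for k
  define \<psi> where "\<psi> k = (case k of 0 \<Rightarrow> 0
     | Suc j \<Rightarrow> filter_step (mk j) (Lk j) (ye j) (u j) (z j - z (Suc j)) (dg j))" for k
  define \<eta> where "\<eta> k = vjoin (xe k) (\<psi> k)" for k
  define out where "out k = filter_output (mk k) (Lk k) \<rho> (\<psi> k) (ye k) (u k)" for k
  define V where "V k = \<eta> k \<bullet> (P (\<theta> k) *v \<eta> k)" for k
  define e where "e k = \<gamma>_\<xi> * (norm (\<Delta>\<xi>_star k))\<^sup>2 + \<gamma>_g * (\<Sum>i\<in>UNIV. (norm (\<Delta>g k (yb k i)))\<^sup>2)" for k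
  \<comment> \<open>both \<open>drift\<close> and the previous gap \<open>qp\<close> are \<open>0\<close> at time \<open>0\<close>, when the filter state is \<open>0\<close> and there is
    no previous iterate\<close>
  define drift where "drift i k = (case k of 0 \<Rightarrow> 0 | Suc j \<Rightarrow>
     (Lk k - mk k) * f_hat f (\<theta> k) (yb j i) - (Lk j - mk j) * f_hat f (\<theta> j) (yb j i))" for i k
  define qp where "qp i k = (case k of 0 \<Rightarrow> 0 | Suc j \<Rightarrow> q j (yb j i))" for i k
  \<comment> \<open>the storage function: the quadratic form of the plant plus the weighted previous gaps\<close>
  define W where "W k = V k + (\<Sum>i\<in>UNIV. lam $ i * qp i k)" for k

  have blk_ye: "blk (ye k) i = yb k i - z k" for k i
    by (simp add: ye_def yb_def blk_vkron)
  have blk_u: "blk (u k) i = grad (h k) (yb k i)" for k i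
    by (simp add: \<open>\<And>k. u k = stack (\<lambda>i. grad_at f (\<theta> k) (blk (y k) i))\<close> yb_def grad_at_def h_def)
  have blk_dg: "blk (dg k) i = grad (h k) (yb k i) - grad (h (Suc k)) (yb k i)" for k i
    by (simp add: dg_def \<Delta>g_def grad_at_def h_def)

  have AU: "A (\<theta> k) *v (U *v v) = U *v v" for k v
  proof -
    have "((mat 1 - A (\<theta> k)) ** U) *v v = 0"
      using \<open>\<And>\<theta>. \<theta> \<in> \<Theta> \<Longrightarrow> (mat 1 - A \<theta>) ** U = 0\<close>[OF \<theta>] by simp
    then show ?thesis
      by (simp add: matrix_vector_mul_assoc[symmetric] matrix_vector_mult_diff_rdistrib)
  qed
  have xe_Suc: "A (\<theta> k) *v xe k + B (\<theta> k) *v u k + \<Delta>\<xi>_star k = xe (Suc k)" for k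
    using \<open>\<And>k. \<xi> (k + 1) = A (\<theta> k) *v \<xi> k + B (\<theta> k) *v u k\<close>[of k]
    by (simp add: xe_def \<Delta>\<xi>_star_def \<xi>_star_def matrix_vector_mult_diff_distrib AU)
  have ye_eq: "ye k = C (\<theta> k) *v xe k + D (\<theta> k) *v u k" for k
  proof -
    have "C (\<theta> k) *v \<xi>_star k = vkron 1 (mat 1) *v z k"
      using \<open>\<And>\<theta>. \<theta> \<in> \<Theta> \<Longrightarrow> C \<theta> ** U = vkron 1 (mat 1)\<close>[OF \<theta>]
      by (simp add: \<xi>_star_def z_def matrix_vector_mul_assoc)
    then show ?thesis
      using \<open>\<And>k. y k = C (\<theta> k) *v \<xi> k + D (\<theta> k) *v u k\<close>[of k]
      by (simp add: ye_def xe_def matrix_vector_mult_diff_distrib)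
  qed
  have CxU: "Cx *v \<Delta>\<xi>_star k = z k - z (Suc k)" for k
    using \<open>Cx ** U = mat 1\<close>
    by (simp add: \<Delta>\<xi>_star_def \<xi>_star_def z_def matrix_vector_mult_diff_distrib
        matrix_vector_mul_assoc)

  have dissipation: "V (Suc k) + (\<Sum>i\<in>UNIV. lam $ i * (blk (out k) i \<bullet> (M_hat *v blk (out k) i)))
      \<le> r * V k + e k" for k
  proof -
    have "(\<theta> k, \<theta> (Suc k) - \<theta> k) \<in> V_set \<Theta> \<nu>_lo \<nu>_up"
      using \<theta> \<open>\<And>k. \<nu>_lo \<le> \<theta> (k + 1) - \<theta> k \<and> \<theta> (k + 1) - \<theta> k \<le> \<nu>_up\<close>[of k]
      by (simp add: V_set_def)
    \<comment> \<open>the matrix inequality at the current parameter and its increment\<close>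
    note lmi = assms(32)[OF this]
    have \<eta>': "\<eta> (Suc k) = vjoin (A (\<theta> k) *v xe k + B (\<theta> k) *v u k + \<Delta>\<xi>_star k)
        (filter_step (m (\<theta> k)) (L (\<theta> k)) (ye k) (u k) (Cx *v \<Delta>\<xi>_star k) (dg k))"
      by (simp add: \<eta>_def xe_Suc \<psi>_def CxU mk_def Lk_def)
    show ?thesis
      using dissipation_inequality[OF ye_eq \<eta>_def \<eta>' out_def[unfolded mk_def Lk_def] lmi]
      by (simp add: V_def e_def r_def dg_def)
  qed

  have supply_rate: "q k (yb k i) - r * qp i k - r * drift i k \<le> blk (out k) i \<bullet> (M_hat *v blk (out k) i)" for k i
  proof (cases k)
    case 0
    have "q 0 (yb 0 i) \<le> (Lk 0 *\<^sub>R (yb 0 i - z 0) - grad (h 0) (yb 0 i))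
        \<bullet> (grad (h 0) (yb 0 i) - mk 0 *\<^sub>R (yb 0 i - z 0))"
      using interpolation_gap_multiplier_bound[OF sm sc mL gz, of 0 "yb 0 i" "z 0"] gz[of 0]
      by (simp add: q_def)
    then show ?thesis
      using m0[of 0] mL[of 0]
      by (simp add: 0 out_def blk_filter_output_quadratic_form[OF _ _ refl] \<psi>_def qp_def drift_def
          blk_ye blk_u)
  next
    case (Suc j)
    \<comment> \<open>makes the square root in the third filter state square to its argument\<close>
    have "0 \<le> mk j * (Lk j - mk j) / 2"
      using m0[of j] mL[of j] by simp
    \<comment> \<open>the weighted suboptimality of the old iterate \<open>yb j i\<close>, under the old and the new function\<close>
    define F where "F l = (Lk l - mk l) * (h l (yb j i) - h l (z l))" for l
    \<comment> \<open>the part of the form that \<open>multiplier_bound_shifted\<close> controls\<close>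
    define c where "c = (Lk k *\<^sub>R (yb k i - z k) - grad (h k) (yb k i)
        - r *\<^sub>R (Lk k *\<^sub>R (yb j i - z k) - grad (h k) (yb j i)))
      \<bullet> (grad (h k) (yb k i) - mk k *\<^sub>R (yb k i - z k))"
    have "blk (out k) i \<bullet> (M_hat *v blk (out k) i) =
        c + r * ((F j - q j (yb j i)) - (F k - q k (yb j i)))"
      using m0[of k] mL[of k] \<open>0 \<le> mk j * (Lk j - mk j) / 2\<close>
      by (simp add: Suc out_def blk_filter_output_quadratic_form[OF _ _ refl] \<psi>_def filter_step_def
          blk_ye blk_u blk_dg q_def interpolation_gap_def r_def power_mult_distrib c_def F_def)
    moreover have "q k (yb k i) - r * q k (yb j i) \<le> c"
      using multiplier_bound_shifted[OF sm sc mL gz, of \<rho>] r unfolding q_def r_def c_def by blast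
    moreover have qp: "qp i k = q j (yb j i)" and drift: "drift i k = F k - F j"
      by (simp_all add: Suc qp_def drift_def f_hat_def h_def z_def F_def)
    ultimately show ?thesis
      unfolding qp drift by (simp add: algebra_simps)
  qed

  have step: "W (Suc k) \<le> r * W k + r * (\<Sum>i\<in>UNIV. lam $ i * drift i k) + e k" for k
  proof -
    have "(\<Sum>i\<in>UNIV. lam $ i * (q k (yb k i) - r * qp i k - r * drift i k))
        \<le> (\<Sum>i\<in>UNIV. lam $ i * (blk (out k) i \<bullet> (M_hat *v blk (out k) i)))"
      using supply_rate \<open>\<And>i. 0 \<le> lam $ i\<close> by (intro sum_mono mult_left_mono) auto
    also have "(\<Sum>i\<in>UNIV. lam $ i * (q k (yb k i) - r * qp i k - r * drift i k)) =
        (\<Sum>i\<in>UNIV. lam $ i * q k (yb k i)) - r * (\<Sum>i\<in>UNIV. lam $ i * qp i k)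
          - r * (\<Sum>i\<in>UNIV. lam $ i * drift i k)"
      by (simp add: sum_subtractf sum.distrib sum_distrib_left algebra_simps)
    finally show ?thesis
      using dissipation[of k] by (simp add: W_def qp_def distrib_left)
  qed

  have "\<Theta> \<noteq> {}" using \<theta> by blast
  have P_sym: "\<And>s. s \<in> \<Theta> \<Longrightarrow> transpose (P s) = P s"
    using P_pos by (simp add: pos_definite_def)
  have up: "v \<bullet> (P (\<theta> k) *v v) \<le> lam_up * (norm v)\<^sup>2" for v k
    unfolding lam_up_def by (metis greatest_lambda_max[OF \<Theta> \<open>\<Theta> \<noteq> {}\<close> P_cont P_sym] \<theta>)
  obtain s where s: "s \<in> \<Theta>" "lam_lo = lambda_min (P s)"
    and lo: "\<And>k v. lam_lo * (norm v)\<^sup>2 \<le> v \<bullet> (P (\<theta> k) *v v)"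
    unfolding lam_lo_def by (metis least_lambda_min[OF \<Theta> \<open>\<Theta> \<noteq> {}\<close> P_cont P_sym] \<theta>)
  have lam_lo: "0 < lam_lo" using s lambda_min_pos[OF P_pos] by simp

  \<comment> \<open>\<open>W\<close> dominates the error at time \<open>k\<close>, and at time \<open>0\<close> it is a quadratic form in the error alone\<close>
  have "lam_lo * (norm (xe k))\<^sup>2 \<le> lam_lo * (norm (\<eta> k))\<^sup>2"
    using lam_lo by (simp add: \<eta>_def norm_vjoin)
  also have "\<dots> \<le> V k" unfolding V_def by (rule lo)
  also have "V k \<le> W k"
    using q0 \<open>\<And>i. 0 \<le> lam $ i\<close>
    by (auto simp: W_def qp_def intro!: sum_nonneg split: nat.split)
  also have "W k \<le> r ^ k * W 0 + (\<Sum>t = 1..k. r ^ (k - t) * e (t - 1))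
      + (\<Sum>t = 1..k - 1. r ^ (k - t) * (\<Sum>i\<in>UNIV. lam $ i * drift i t))"
    by (rule geometric_recursion_bound) (use step r(1) in \<open>simp_all add: drift_def\<close>)
  also have "r ^ k * W 0 \<le> r ^ k * (lam_up * (norm (xe 0))\<^sup>2)"
    using up[of "\<eta> 0" 0] r(1)
    by (intro mult_left_mono) (simp_all add: W_def qp_def V_def \<eta>_def norm_vjoin \<psi>_def)
  finally have main: "lam_lo * (norm (xe k))\<^sup>2 \<le> r ^ k * (lam_up * (norm (xe 0))\<^sup>2)
      + (\<Sum>t = 1..k. r ^ (k - t) * e (t - 1))
      + (\<Sum>t = 1..k - 1. r ^ (k - t) * (\<Sum>i\<in>UNIV. lam $ i * drift i t))"
    by simp
  have "(\<Sum>t = 1..k - 1. r ^ (k - t) * (\<Sum>i\<in>UNIV. lam $ i * drift i t)) =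
      (\<Sum>i\<in>UNIV. \<Sum>t = 1..k - 1. r ^ (k - t) * lam $ i * drift i t)"
    by (subst sum.swap) (simp add: sum_distrib_left mult.assoc)
  also have "\<dots> = (\<Sum>i\<in>UNIV. \<Sum>t = 1..k - 1. r ^ (k - t) * lam $ i *
      ((Lk t - mk t) * f_hat f (\<theta> t) (yb (t - 1) i)
       - (Lk (t - 1) - mk (t - 1)) * f_hat f (\<theta> (t - 1)) (yb (t - 1) i)))"
    by (intro sum.cong refl arg_cong2[of _ _ _ _ "(*)"]) (auto simp: drift_def split: nat.split)
  finally have drift_sum: "(\<Sum>t = 1..k - 1. r ^ (k - t) * (\<Sum>i\<in>UNIV. lam $ i * drift i t)) = \<dots>" .
  have pow: "\<rho> ^ (2 * j) = r ^ j" for j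
    by (simp add: r_def power_mult)
  have "(norm (xe k))\<^sup>2 \<le> (r ^ k * (lam_up * (norm (xe 0))\<^sup>2)
      + (\<Sum>t = 1..k. r ^ (k - t) * e (t - 1))
      + (\<Sum>t = 1..k - 1. r ^ (k - t) * (\<Sum>i\<in>UNIV. lam $ i * drift i t))) / lam_lo"
    using main lam_lo by (simp add: pos_le_divide_eq mult.commute)
  then show ?thesis
    unfolding drift_sum pow c1_def c2_def
    by (simp add: xe_def e_def yb_def mk_def Lk_def add_divide_distrib mult_ac)
qed

end
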